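(* Let $\mathfrak g$ be a finite-dimensional graded vector space together with a family of graded linear maps $\ell=\{\ell^i:\bigwedge^i\mathfrak g\to\mathfrak g[2-i]\}_{i\ge1}$. Define the finitely generated completed free commutative graded algebra $\mathrm{CE}_{\mathfrak g}:=\widehat{\mathrm{Sym}}(\mathfrak g^*[-1])$ and the graded linear map $\delta:\mathrm{CE}_{\mathfrak g}\to\mathrm{CE}_{\mathfrak g}[1]$ (extended as a derivation) on generators $\theta^\alpha$ by $$\delta\theta^\alpha:=\sum_{i=1}^\infty\frac{1}{i!}(-1)^{\sum_{l=1}^i|x_{\alpha_l}|\,(l+|x_{\alpha_{l+1}}\cdots x_{\alpha_i}|)}\,\ell^\alpha_{\alpha_1,\ldots,\alpha_i}\,\theta^{\alpha_1}\cdots\theta^{\alpha_i}.$$ Then $\delta$ is a differential (i.e. $\delta^2=0$) if and only if $\ell$ satisfies the generalised Jacobi identity: for all $k\ge1$ and all $1\le\alpha,\alpha_1,\ldots,\alpha_k\le\dim(\mathfrak g)$, $$\sum_{\tilde i+j=k}\ \sum_{\sigma\in\mathrm S_{\tilde i,j}}\varepsilon_\sigma\,(-1)^{j\big(\tilde i+|x_{\alpha_{\sigma(1)}}\cdots x_{\alpha_{\sigma(\tilde i)}}|\big)}\,\ell^\alpha_{\alpha_{\sigma(1)},\ldots,\alpha_{\sigma(\tilde i)},\beta}\,\ell^\beta_{\alpha_{\sigma(i)},\ldots,\alpha_{\sigma(k)}}=0,$$ where $i,j\ge1$.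
   Context: $\mathbb K$ is a field of characteristic $0$; graded vector spaces are $\mathbb Z$-graded; $V[n]^m:=V^{m+n}$; a map $V\to W[n]$ is a linear map of degree $n$; Koszul signs are used throughout. $\tilde i:=i-1$. $\bigwedge^i$ is the graded exterior power, so the $\ell^i$ are graded skew-symmetric. $\{x_\alpha\}_{1\le\alpha\le\dim\mathfrak g}$ is a homogeneous basis of $\mathfrak g$ and $|x_{\beta_1}\cdots x_{\beta_m}|:=|x_{\beta_1}|+\dots+|x_{\beta_m}|$ (zero for the empty product). The structure constants are defined by $\ell^i(x_{\alpha_1},\ldots,x_{\alpha_i})=\ell^\alpha_{\alpha_1,\ldots,\alpha_i}x_\alpha$; repeated indices are summed over $1,\dots,\dim\mathfrak g$ (Einstein convention). $\{x^\alpha\}$ is the dual basis and $\theta^\alpha$ is the generator of $\mathfrak g^*[-1]$ corresponding to $x^\alpha$, of degree $1-|x_\alpha|$. $\widehat{\mathrm{Sym}}(U):=\prod_{i\in\mathbb N}\mathrm{Sym}^i(U)$ (graded-commutative symmetric powers, product of graded vector spaces), a graded-commutative algebra. The map $\delta$ is extended from generators to all of $\widehat{\mathrm{Sym}}(\mathfrak g^*[-1])$ by the graded Leibniz law $\delta(aa')=\delta(a)a'+(-1)^{|a|}a\,\delta(a')$. $\mathrm S_{\tilde i,j}\subseteq\mathrm S_{\tilde i+j}$ is the set of permutations with $\sigma(1)<\dots<\sigma(\tilde i)$ and $\sigma(\tilde i+1)<\dots<\sigma(\tilde i+j)$; $\varepsilon_\sigma$ is $\mathrm{sgn}(\sigma)$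 times the Koszul sign of rearranging $x_{\alpha_1}\otimes\cdots\otimes x_{\alpha_k}$ into $x_{\alpha_{\sigma(1)}}\otimes\cdots\otimes x_{\alpha_{\sigma(k)}}$. The displayed identity is the coordinate form of $\sum_{\tilde i+j=k}(-1)^{\tilde ij}\ell^i(1_{\tilde i}\otimes\ell^j)\Sigma_{\tilde i,j}=0$ for all $k\ge 1$, where $\Sigma_{\tilde i,j}(x_1\otimes\cdots\otimes x_k)=\sum_{\sigma\in\mathrm S_{\tilde i,j}}\varepsilon_\sigma x_{\sigma(1)}\otimes\cdots\otimes x_{\sigma(k)}$ and $1_{\tilde i}$ is the identity of $\mathfrak g^{\otimes\tilde i}$. *)

theory Defs
  imports Complex_Main "HOL-Library.Multiset" "HOL-Combinatorics.Permutations"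
begin

section \<open>Graded vector spaces and graded skew-symmetric operations\<close>

text \<open>A graded vector space is the type \<open>'v\<close> (a vector space over \<open>'k\<close> via \<open>scale\<close>) together with
  its homogeneous components \<open>G m\<close>, of which it is the direct sum.\<close>

definition is_grading ::
  "('k::field \<Rightarrow> 'v::ab_group_add \<Rightarrow> 'v) \<Rightarrow> (int \<Rightarrow> 'v set) \<Rightarrow> bool" where
  "is_grading scale G \<longleftrightarrow>
     (\<forall>m. module.subspace scale (G m)) \<and>
     (\<forall>v. \<exists>!c. (\<forall>m. c m \<in> G m) \<and> finite {m. c m \<noteq> 0} \<and> v = (\<Sum>m | c m \<noteq> 0. c m))"

text \<open>The basis is \<open>x 1, \<dots>, x n\<close>; the function \<open>d\<close> records the degrees, so \<open>d \<alpha>\<close> is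
  \<open>|x\<^sub>\<alpha>|\<close> (basis vectors are nonzero, so this degree is unique).\<close>

definition homogeneous_basis ::
  "('k::field \<Rightarrow> 'v::ab_group_add \<Rightarrow> 'v) \<Rightarrow> (int \<Rightarrow> 'v set) \<Rightarrow> nat \<Rightarrow> (nat \<Rightarrow> 'v) \<Rightarrow> (nat \<Rightarrow> int) \<Rightarrow> bool" where
  "homogeneous_basis scale G n x d \<longleftrightarrow>
     inj_on x {1..n} \<and>
     \<not> module.dependent scale (x ` {1..n}) \<and>
     module.span scale (x ` {1..n}) = UNIV \<and>
     (\<forall>\<alpha>\<in>{1..n}. x \<alpha> \<in> G (d \<alpha>))"

text \<open>A family of graded linear maps \<open>\<Lambda>\<^sup>i \<gg> \<rightarrow> \<gg>[2 - i]\<close>, \<open>i \<ge> 1\<close>, given as the corresponding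
  multilinear, graded skew-symmetric maps; \<open>L i\<close> is only relevant on lists of length \<open>i\<close>.
  With the convention that the degree \<open>m\<close> part of \<open>V[k]\<close> is the degree \<open>m + k\<close> part of \<open>V\<close>, the map
  \<open>L i\<close> raises the total degree by \<open>2 - i\<close>.\<close>

definition graded_skew_family ::
  "('k::field \<Rightarrow> 'v::ab_group_add \<Rightarrow> 'v) \<Rightarrow> (int \<Rightarrow> 'v set) \<Rightarrow> (nat \<Rightarrow> 'v list \<Rightarrow> 'v) \<Rightarrow> bool" where
  "graded_skew_family scale G L \<longleftrightarrow>
     (\<forall>i\<ge>1. \<forall>vs. length vs = i \<longrightarrow>
        (\<forall>p<i. Vector_Spaces.linear scale scale (\<lambda>v. L i (vs[p := v]))) \<and>
        (\<forall>ms. length ms = i \<and> (\<forall>p<i. vs ! p \<in> G (ms ! p)) \<longrightarrow>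
           L i vs \<in> G (sum_list ms + (2 - int i))) \<and>
        (\<forall>p a b. Suc p < i \<and> vs ! p \<in> G a \<and> vs ! Suc p \<in> G b \<longrightarrow>
           L i (vs[p := vs ! Suc p, Suc p := vs ! p]) = scale (- ((-1) powi (a * b))) (L i vs)))"

text \<open>\<open>struct_const scale n x L \<alpha> [\<alpha>\<^sub>1, \<dots>, \<alpha>\<^sub>i]\<close> is the coefficient of \<open>x \<alpha>\<close> in
  \<open>L i [x \<alpha>\<^sub>1, \<dots>, x \<alpha>\<^sub>i]\<close>.\<close>

definition struct_const ::
  "('k::field \<Rightarrow> 'v::ab_group_add \<Rightarrow> 'v) \<Rightarrow> nat \<Rightarrow> (nat \<Rightarrow> 'v) \<Rightarrow> (nat \<Rightarrow> 'v list \<Rightarrow> 'v)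
     \<Rightarrow> nat \<Rightarrow> nat list \<Rightarrow> 'k" where
  "struct_const scale n x L \<alpha> as =
     module.representation scale (x ` {1..n}) (L (length as) (map x as)) (x \<alpha>)"


section \<open>The completed free graded-commutative algebra on the generators \<open>\<theta>\<^sup>\<alpha>\<close>\<close>

text \<open>The generator \<open>\<theta>\<^sup>\<alpha>\<close>, \<open>1 \<le> \<alpha> \<le> n\<close>, has degree \<open>1 - d \<alpha>\<close>. The symmetric power of weight \<open>i\<close> has
  as basis the ordered products \<open>\<theta>\<^sup>M\<close> of generators with indices \<open>\<beta>\<^sub>1 \<le> \<dots> \<le> \<beta>\<^sub>i\<close>, in which no generator of
  odd degree is repeated; they are indexed by the multiset \<open>M = {#\<beta>\<^sub>1, \<dots>, \<beta>\<^sub>i#}\<close>. An element of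
  the completed algebra is a formal series \<open>\<Sum>\<^sub>M f M \<theta>\<^sup>M\<close>, represented by its coefficient function
  \<open>f\<close>.\<close>

definition theta_deg :: "(nat \<Rightarrow> int) \<Rightarrow> nat \<Rightarrow> int" where
  "theta_deg d \<alpha> = 1 - d \<alpha>"

definition ce_monomial :: "nat \<Rightarrow> (nat \<Rightarrow> int) \<Rightarrow> nat multiset \<Rightarrow> bool" where
  "ce_monomial n d M \<longleftrightarrow>
     set_mset M \<subseteq> {1..n} \<and> (\<forall>\<alpha>. odd (theta_deg d \<alpha>) \<longrightarrow> count M \<alpha> \<le> 1)"

definition ce_deg :: "(nat \<Rightarrow> int) \<Rightarrow> nat multiset \<Rightarrow> int" where
  "ce_deg d M = (\<Sum>\<alpha>\<in>#M. theta_deg d \<alpha>)"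

text \<open>The product over weights is taken in graded vector spaces, i.e. separately in each degree, so
  that an element of the total space has only finitely many nonzero homogeneous components (each
  of which may be an infinite series).\<close>

definition CE :: "nat \<Rightarrow> (nat \<Rightarrow> int) \<Rightarrow> (nat multiset \<Rightarrow> 'k::field) set" where
  "CE n d = {f. (\<forall>M. f M \<noteq> 0 \<longrightarrow> ce_monomial n d M) \<and> finite (ce_deg d ` {M. f M \<noteq> 0})}"

text \<open>\<open>\<theta>\<^sup>P \<theta>\<^sup>Q\<close> is \<open>ce_sign d P Q\<close> times the monomial of \<open>P + Q\<close>, and \<open>\<theta>\<^sup>P \<theta>\<^sup>Q = 0\<close> if \<open>P + Q\<close> repeats a generator of odd degree:
  the Koszul sign of sorting the concatenation counts the pairs consisting of a factor of \<open>\<theta>\<^sup>P\<close>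
  with larger index than a factor of \<open>\<theta>\<^sup>Q\<close>, weighted by the product of their degrees.\<close>

definition ce_sign :: "(nat \<Rightarrow> int) \<Rightarrow> nat multiset \<Rightarrow> nat multiset \<Rightarrow> 'k::field" where
  "ce_sign d P Q =
     (-1) powi (\<Sum>\<alpha>\<in>#P. \<Sum>\<beta>\<in>#{#\<beta> \<in># Q. \<beta> < \<alpha>#}. theta_deg d \<alpha> * theta_deg d \<beta>)"

definition ce_mult :: "nat \<Rightarrow> (nat \<Rightarrow> int) \<Rightarrow>
    (nat multiset \<Rightarrow> 'k::field) \<Rightarrow> (nat multiset \<Rightarrow> 'k) \<Rightarrow> (nat multiset \<Rightarrow> 'k)" where
  "ce_mult n d f g = (\<lambda>M. if ce_monomial n d M
       then \<Sum>P | P \<subseteq># M. ce_sign d P (M - P) * f P * g (M - P) else 0)"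

definition ce_one :: "nat multiset \<Rightarrow> 'k::field" where
  "ce_one = (\<lambda>M. if M = {#} then 1 else 0)"

definition theta :: "nat \<Rightarrow> (nat multiset \<Rightarrow> 'k::field)" where
  "theta \<alpha> = (\<lambda>M. if M = {#\<alpha>#} then 1 else 0)"

definition theta_word :: "nat \<Rightarrow> (nat \<Rightarrow> int) \<Rightarrow> nat list \<Rightarrow> (nat multiset \<Rightarrow> 'k::field)" where
  "theta_word n d as = foldr (\<lambda>\<alpha> f. ce_mult n d (theta \<alpha>) f) as ce_one"


section \<open>The derivation\<close>

text \<open>\<open>\<delta>\<theta>\<^sup>\<alpha>\<close> for structure constants \<open>c\<close>. A product of \<open>i\<close> generators has weight \<open>i\<close>, so it
  contributes to the coefficient of \<open>\<theta>\<^sup>M\<close> only for \<open>i = size M\<close>; this is why truncating the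
  infinite sum over \<open>i\<close> at \<open>size M\<close> is harmless. List positions start at \<open>0\<close>, so \<open>\<alpha>\<^sub>l\<close> is
  \<open>as ! (l - 1)\<close>.\<close>

definition delta_gen :: "nat \<Rightarrow> (nat \<Rightarrow> int) \<Rightarrow> (nat \<Rightarrow> nat list \<Rightarrow> 'k::field_char_0) \<Rightarrow>
    nat \<Rightarrow> (nat multiset \<Rightarrow> 'k)" where
  "delta_gen n d c \<alpha> = (\<lambda>M. \<Sum>i=1..size M. \<Sum>as | length as = i \<and> set as \<subseteq> {1..n}.
     1 / fact i
     * (-1) powi (\<Sum>l=1..i. d (as ! (l - 1)) * (int l + (\<Sum>m=l+1..i. d (as ! (m - 1)))))
     * c \<alpha> as * theta_word n d as M)"

text \<open>Graded Leibniz law on a product of generators (\<open>\<delta>\<close> has degree \<open>1\<close>, \<open>\<delta> 1 = 0\<close>).\<close>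

primrec delta_word :: "nat \<Rightarrow> (nat \<Rightarrow> int) \<Rightarrow> (nat \<Rightarrow> nat list \<Rightarrow> 'k::field_char_0) \<Rightarrow>
    nat list \<Rightarrow> (nat multiset \<Rightarrow> 'k)" where
  "delta_word n d c [] = (\<lambda>M. 0)"
| "delta_word n d c (\<beta> # w) = (\<lambda>M.
      ce_mult n d (delta_gen n d c \<beta>) (theta_word n d w) M
    + (-1) powi (theta_deg d \<beta>) * ce_mult n d (theta \<beta>) (delta_word n d c w) M)"

text \<open>Extension to formal series, \<open>\<delta> (\<Sum>\<^sub>N f N \<theta>\<^sup>N) = \<Sum>\<^sub>N f N \<delta> (\<theta>\<^sup>N)\<close>. As \<open>\<delta>\<close> never lowers the weight,
  only the finitely many \<open>N\<close> with \<open>size N \<le> size M\<close> contribute to the coefficient of \<open>\<theta>\<^sup>M\<close>.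
  This is the only extension of \<open>\<delta>\<close> from the generators to a graded derivation: a derivation maps
  the ideal of series of weight \<open>\<ge> i + 1\<close>, which is the \<open>(i + 1)\<close>-st power of the augmentation
  ideal, into the ideal of series of weight \<open>\<ge> i\<close>, hence is determined by its values on
  monomials.\<close>

definition delta :: "nat \<Rightarrow> (nat \<Rightarrow> int) \<Rightarrow> (nat \<Rightarrow> nat list \<Rightarrow> 'k::field_char_0) \<Rightarrow>
    (nat multiset \<Rightarrow> 'k) \<Rightarrow> (nat multiset \<Rightarrow> 'k)" where
  "delta n d c f = (\<lambda>M. \<Sum>N | ce_monomial n d N \<and> size N \<le> size M.
     f N * delta_word n d c (sorted_list_of_multiset N) M)"


section \<open>The generalised Jacobi identity\<close>

definition unshuffles :: "nat \<Rightarrow> nat \<Rightarrow> (nat \<Rightarrow> nat) set" where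
  "unshuffles p q = {\<sigma>. \<sigma> permutes {1..p+q} \<and>
     strict_mono_on {1..p} \<sigma> \<and> strict_mono_on {p+1..p+q} \<sigma>}"

text \<open>\<open>\<epsilon>\<^sub>\<sigma>\<close>: the sign of \<open>\<sigma>\<close> times the Koszul sign of rearranging factors of degrees
  \<open>e 1, \<dots>, e k\<close> into the order \<open>\<sigma> 1, \<dots>, \<sigma> k\<close>.\<close>

definition perm_sign :: "nat \<Rightarrow> (nat \<Rightarrow> int) \<Rightarrow> (nat \<Rightarrow> nat) \<Rightarrow> 'k::field" where
  "perm_sign k e \<sigma> = of_int (sign \<sigma>) *
     (\<Prod>(p, q) | 1 \<le> p \<and> p < q \<and> q \<le> k \<and> \<sigma> p > \<sigma> q. (-1) powi (e (\<sigma> p) * e (\<sigma> q)))"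

text \<open>Here \<open>a 1, \<dots>, a k\<close> are the indices \<open>\<alpha>\<^sub>1, \<dots>, \<alpha>\<^sub>k\<close>. The two inner lists are
  \<open>\<sigma> 1, \<dots>, \<sigma> (i - 1)\<close> and \<open>\<sigma> i, \<dots>, \<sigma> k\<close>, with \<open>i - 1 + j = k\<close>.\<close>

definition generalised_jacobi ::
  "nat \<Rightarrow> (nat \<Rightarrow> int) \<Rightarrow> (nat \<Rightarrow> nat list \<Rightarrow> 'k::field) \<Rightarrow> bool" where
  "generalised_jacobi n d c \<longleftrightarrow>
     (\<forall>k\<ge>1. \<forall>\<alpha>\<in>{1..n}. \<forall>a. (\<forall>p\<in>{1..k}. a p \<in> {1..n}) \<longrightarrow>
        (\<Sum>(i, j) | 1 \<le> i \<and> 1 \<le> j \<and> (i - 1) + j = k. \<Sum>\<sigma>\<in>unshuffles (i - 1) j.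
           perm_sign k (\<lambda>p. d (a p)) \<sigma>
           * (-1) powi (int j * (int (i - 1) + (\<Sum>p=1..i-1. d (a (\<sigma> p)))))
           * (\<Sum>\<beta>=1..n. c \<alpha> (map (\<lambda>p. a (\<sigma> p)) [1..<i] @ [\<beta>])
                         * c \<beta> (map (\<lambda>p. a (\<sigma> p)) [i..<k+1]))) = 0)"

end

theory Submission
  imports Defs
begin

text \<open>
  A graded derivation is determined by its values on the generators, and the square of an odd
  derivation is an even derivation. Hence \<open>\<delta>\<^sup>2 = 0\<close> if and only if \<open>\<delta>\<^sup>2 \<theta>\<^sup>\<alpha> = 0\<close> for every \<open>\<alpha>\<close>
  (\<open>delta_square_zero_iff_generators\<close>), and it remains to see that the coefficients of \<open>\<delta>\<^sup>2 \<theta>\<^sup>\<alpha>\<close> are the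
  left-hand sides of the generalised Jacobi identity.

  Two notions organise the argument. A function \<open>F\<close> of words is \<^emph>\<open>graded symmetric\<close> for a symmetric
  sign \<open>\<kappa>\<close> if exchanging adjacent letters \<open>a\<close>, \<open>b\<close> multiplies it by \<open>\<kappa> a b\<close>. Products of generators
  and the derivatives of such products are graded symmetric for the Koszul sign of the generators;
  structure constants are graded symmetric for minus the Koszul sign of the basis vectors, and the
  sign in the definition of \<open>\<delta>\<close> is exactly what turns the second kind of symmetry into the first. The
  values of a graded-symmetric function at two words with the same letters agree up to a sign that
  does not depend on the function, which is what allows different such functions to be compared. A \<^emph>\<open>filtered linear\<close> operator is one
  whose value at a monomial of weight \<open>k\<close> depends linearly on the coefficients of weight at most \<open>k\<close>; such
  operators respect formal sums of monomials, so that identities between \<open>\<delta>\<close>, multiplications and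
  the parity automorphism need to be checked on words in the generators only.

  By the Leibniz law and graded symmetry, applying \<open>\<delta>\<close> to a product in \<open>\<delta>\<theta>\<^sup>\<alpha>\<close> amounts to
  differentiating its last factor, as many times as there are factors. Thus \<open>\<delta>\<^sup>2 \<theta>\<^sup>\<alpha>\<close> is a sum of words
  \<open>\<theta>\<^sup>u \<theta>\<^sup>v\<close> whose coefficients \<open>composite \<alpha> u v\<close> insert the bracket of \<open>v\<close> into the last slot of the
  bracket with \<open>u\<close>, weighted by \<open>1 / (p! q!)\<close> with \<open>p\<close>, \<open>q\<close> the lengths of \<open>u\<close>, \<open>v\<close>. A word of length \<open>k\<close>
  has \<open>k! / (p! q!)\<close> unshuffles into words of lengths \<open>p\<close> and \<open>q\<close>, which absorbs the weights: \<open>k! \<delta>\<^sup>2 \<theta>\<^sup>\<alpha>\<close>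
  is, in weight \<open>k\<close>, the sum over all words \<open>w\<close> of \<open>\<theta>\<^sup>w\<close> times the sum of \<open>composite \<alpha>\<close> over the unshuffles
  of \<open>w\<close> (\<open>delta_square_generator\<close>). Because the brackets have degree \<open>2 - i\<close>, the
  latter sum is the Jacobi expression of \<open>w\<close> up to a sign depending on \<open>w\<close> only
  (\<open>unshuffle_sum_composite\<close>), and so the Jacobi identity implies \<open>\<delta>\<^sup>2 = 0\<close>.

  Conversely, the Jacobi expression is itself graded symmetric in \<open>w\<close>. It therefore vanishes if \<open>w\<close>
  repeats a generator of odd degree; otherwise all words with the letters of \<open>w\<close> contribute the same
  to the coefficient of \<open>\<delta>\<^sup>2 \<theta>\<^sup>\<alpha>\<close> at the corresponding monomial, so that this coefficient is a
  nonzero multiple of the Jacobi expression, the characteristic being \<open>0\<close>.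
\<close>

section \<open>Words and graded-symmetric functions\<close>

lemma minus_one_powi: "(-1 :: 'k::field) powi m = (if even m then 1 else - 1)"
  by (cases "m \<ge> 0") (auto simp: power_int_def even_nat_iff)

lemma minus_one_powi_cong: "even (a - b) \<Longrightarrow> (-1 :: 'k::field) powi a = (-1) powi b"
  by (simp add: minus_one_powi)

lemma minus_one_powi_mult: "(-1 :: 'k::field) powi a * (-1) powi b = (-1) powi (a + b)"
  by (simp add: power_int_add)

lemma minus_one_powi_square: "(-1 :: 'k::field) powi a * (-1) powi a = 1"
  by (simp add: minus_one_powi)

definition words :: "'a set \<Rightarrow> nat \<Rightarrow> 'a list set" where
  "words X k = {w. length w = k \<and> set w \<subseteq> X}"

lemma words_0 [simp]: "words X 0 = {[]}"
  by (auto simp: words_def)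

lemma finite_words [simp]: "finite X \<Longrightarrow> finite (words X k)"
  unfolding words_def using finite_lists_length_eq[of X k] by (simp add: conj_commute)

lemma sum_words_Suc:
  "(\<Sum>w\<in>words X (Suc k). f w) = (\<Sum>a\<in>X. \<Sum>w\<in>words X k. f (a # w))"
proof -
  have "(\<Sum>w\<in>words X (Suc k). f w) = (\<Sum>(a, w)\<in>X \<times> words X k. f (a # w))"
    by (rule sum.reindex_bij_witness[of _ "\<lambda>(a, w). a # w" "\<lambda>w. (hd w, tl w)"])
      (auto simp: words_def length_Suc_conv)
  then show ?thesis by (simp add: sum.cartesian_product)
qed

definition commutation_factor :: "('a \<Rightarrow> 'a \<Rightarrow> 'k::comm_ring_1) \<Rightarrow> bool" where
  "commutation_factor \<kappa> \<longleftrightarrow> (\<forall>a b. \<kappa> a b = \<kappa> b a \<and> \<kappa> a b * \<kappa> a b = 1)"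

definition graded_symmetric ::
  "('a \<Rightarrow> 'a \<Rightarrow> 'k::comm_ring_1) \<Rightarrow> ('a list \<Rightarrow> 'k) \<Rightarrow> bool" where
  "graded_symmetric \<kappa> F \<longleftrightarrow> (\<forall>u a b v. F (u @ a # b # v) = \<kappa> a b * F (u @ b # a # v))"

definition pass_factor :: "('a \<Rightarrow> 'a \<Rightarrow> 'k::comm_ring_1) \<Rightarrow> 'a \<Rightarrow> 'a list \<Rightarrow> 'k" where
  "pass_factor \<kappa> x u = (\<Prod>c\<leftarrow>u. \<kappa> x c)"

lemma pass_factor_simps [simp]:
  "pass_factor \<kappa> x [] = 1" "pass_factor \<kappa> x (c # u) = \<kappa> x c * pass_factor \<kappa> x u"
  by (simp_all add: pass_factor_def)

lemma pass_factor_append [simp]: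
  "pass_factor \<kappa> x (u @ v) = pass_factor \<kappa> x u * pass_factor \<kappa> x v"
  by (simp add: pass_factor_def)

lemma pass_factor_square:
  assumes "commutation_factor \<kappa>"
  shows "pass_factor \<kappa> x u * pass_factor \<kappa> x u = 1"
proof (induction u)
  case (Cons c u)
  have "pass_factor \<kappa> x (c # u) * pass_factor \<kappa> x (c # u)
      = (\<kappa> x c * \<kappa> x c) * (pass_factor \<kappa> x u * pass_factor \<kappa> x u)"
    by (simp add: algebra_simps)
  then show ?case using Cons assms by (simp add: commutation_factor_def)
qed simp

lemma graded_symmetric_swap:
  "graded_symmetric \<kappa> F \<Longrightarrow> F (u @ a # b # v) = \<kappa> a b * F (u @ b # a # v)"
  unfolding graded_symmetric_def by blast

lemma graded_symmetric_prefix: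
  "graded_symmetric \<kappa> F \<Longrightarrow> graded_symmetric \<kappa> (\<lambda>w. F (z @ w))"
  unfolding graded_symmetric_def by (metis append.assoc)

lemma graded_symmetric_Cons:
  "graded_symmetric \<kappa> F \<Longrightarrow> graded_symmetric \<kappa> (\<lambda>w. F (x # w))"
  using graded_symmetric_prefix[of \<kappa> F "[x]"] by simp

lemma graded_symmetric_pass_mult:
  assumes "graded_symmetric \<kappa> F"
  shows "graded_symmetric \<kappa> (\<lambda>w. pass_factor \<kappa>' x w * F w)"
  unfolding graded_symmetric_def
proof (intro allI)
  fix u a b v
  show "pass_factor \<kappa>' x (u @ a # b # v) * F (u @ a # b # v)
      = \<kappa> a b * (pass_factor \<kappa>' x (u @ b # a # v) * F (u @ b # a # v))"
    using graded_symmetric_swap[OF assms, of u a b v] by (simp add: algebra_simps)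
qed

lemma graded_symmetric_scale:
  assumes "graded_symmetric \<kappa> F"
  shows "graded_symmetric \<kappa> (\<lambda>w. s * F w)"
  unfolding graded_symmetric_def
proof (intro allI)
  fix u a b v
  show "s * F (u @ a # b # v) = \<kappa> a b * (s * F (u @ b # a # v))"
    using graded_symmetric_swap[OF assms, of u a b v] by (simp add: algebra_simps)
qed

lemma graded_symmetric_move:
  assumes "commutation_factor \<kappa>" "graded_symmetric \<kappa> F"
  shows "F (z @ u @ x # v) = pass_factor \<kappa> x u * F (z @ x # u @ v)"
proof (induction u arbitrary: z)
  case (Cons y u)
  have "F (z @ (y # u) @ x # v) = F ((z @ [y]) @ u @ x # v)" by simp
  also have "\<dots> = pass_factor \<kappa> x u * F (z @ y # x # u @ v)"
    by (subst Cons) simp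
  also have "F (z @ y # x # u @ v) = \<kappa> x y * F (z @ x # y # u @ v)"
    using assms unfolding commutation_factor_def graded_symmetric_def by metis
  finally show ?case by (simp add: algebra_simps)
qed simp

text \<open>The sign \<open>s\<close> is chosen before \<open>F\<close>: whichever sequence of adjacent exchanges leads from \<open>w'\<close> to
  \<open>w\<close>, it acts on all graded-symmetric functions by the same factor. This uniformity makes it possible
  to compare different functions of words without computing that sign.\<close>

lemma graded_symmetric_same_letters:
  fixes \<kappa> :: "'a \<Rightarrow> 'a \<Rightarrow> 'k::comm_ring_1"
  assumes \<kappa>: "commutation_factor \<kappa>" and "mset w = mset w'"
  obtains s where "s * s = 1" "\<And>F. graded_symmetric \<kappa> F \<Longrightarrow> F w = s * F w'"
proof -
  have "\<exists>s. s * s = 1 \<and> (\<forall>F. graded_symmetric \<kappa> F \<longrightarrow> F w = s * F w')"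
    using assms(2)
  proof (induction w' arbitrary: w)
    case Nil
    then show ?case by (intro exI[of _ 1]) simp
  next
    case (Cons x w')
    then have "x \<in> set w" by (metis list.set_intros(1) set_mset_mset)
    then obtain u v where w: "w = u @ x # v" by (meson split_list)
    then have "mset (u @ v) = mset w'" using Cons.prems by simp
    from Cons.IH[OF this] obtain s where s: "s * s = 1"
      "\<forall>F. graded_symmetric \<kappa> F \<longrightarrow> F (u @ v) = s * F w'" by blast
    have "(pass_factor \<kappa> x u * s) * (pass_factor \<kappa> x u * s)
        = (pass_factor \<kappa> x u * pass_factor \<kappa> x u) * (s * s)"
      by (simp add: algebra_simps)
    also have "\<dots> = 1" using s(1) pass_factor_square[OF \<kappa>] by simp
    finally have sq: "(pass_factor \<kappa> x u * s) * (pass_factor \<kappa> x u * s) = 1" .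
    have "F w = (pass_factor \<kappa> x u * s) * F (x # w')" if F: "graded_symmetric \<kappa> F" for F
      using graded_symmetric_move[OF \<kappa> F, of "[]" u x v]
        s(2)[rule_format, OF graded_symmetric_Cons[OF F], of x] w
      by (simp add: mult.assoc)
    with sq show ?case by blast
  qed
  with that show thesis by blast
qed

section \<open>Sums over unshuffles of a word\<close>

text \<open>The sum of \<open>H u v\<close> over all ways of splitting the word into a subword \<open>u\<close> and the complementary
  subword \<open>v\<close>, each with the sign of moving the letters of \<open>u\<close> to the front. The recursion decides
  where the first letter goes; in the second summand it has to be passed by the letters of \<open>u\<close>.
  In other words, \<open>unshuffle_sum\<close> pairs \<open>H\<close> with the coproduct of the free graded-commutative algebra.\<close>

primrec unshuffle_sum ::
  "('a \<Rightarrow> 'a \<Rightarrow> 'k::comm_ring_1) \<Rightarrow> 'a list \<Rightarrow> ('a list \<Rightarrow> 'a list \<Rightarrow> 'k) \<Rightarrow> 'k" where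
  "unshuffle_sum \<kappa> [] H = H [] []"
| "unshuffle_sum \<kappa> (x # w) H =
     unshuffle_sum \<kappa> w (\<lambda>u v. H (x # u) v)
     + unshuffle_sum \<kappa> w (\<lambda>u v. pass_factor \<kappa> x u * H u (x # v))"

lemma unshuffle_sum_cong:
  assumes "\<And>u v. mset u + mset v = mset w \<Longrightarrow> H u v = H' u v"
  shows "unshuffle_sum \<kappa> w H = unshuffle_sum \<kappa> w H'"
  using assms
proof (induction w arbitrary: H H')
  case (Cons x w)
  have "unshuffle_sum \<kappa> w (\<lambda>u v. H (x # u) v) = unshuffle_sum \<kappa> w (\<lambda>u v. H' (x # u) v)"
    by (rule Cons.IH) (use Cons.prems in simp)
  moreover have "unshuffle_sum \<kappa> w (\<lambda>u v. pass_factor \<kappa> x u * H u (x # v))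
      = unshuffle_sum \<kappa> w (\<lambda>u v. pass_factor \<kappa> x u * H' u (x # v))"
    by (rule Cons.IH) (use Cons.prems in simp)
  ultimately show ?case by simp
qed simp

lemma unshuffle_sum_scale:
  "unshuffle_sum \<kappa> w (\<lambda>u v. s * H u v) = s * unshuffle_sum \<kappa> w H"
proof (induction w arbitrary: H)
  case (Cons x w)
  show ?case
    using Cons.IH[of "\<lambda>u v. H (x # u) v"] Cons.IH[of "\<lambda>u v. pass_factor \<kappa> x u * H u (x # v)"]
    by (simp add: algebra_simps)
qed simp

text \<open>The product dual to the unshuffle coproduct is again graded symmetric. Removing a common first
  letter keeps the hypotheses, so only the exchange of the first two letters has to be examined:
  if both end up in the same part, the symmetry of \<open>H\<close> in that argument gives the sign, and if they are
  separated, the sign comes from one letter passing the other.\<close>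

lemma graded_symmetric_unshuffle_sum:
  assumes \<kappa>: "commutation_factor \<kappa>"
    and "\<And>v. graded_symmetric \<kappa> (\<lambda>u. H u v)" "\<And>u. graded_symmetric \<kappa> (H u)"
  shows "graded_symmetric \<kappa> (\<lambda>w. unshuffle_sum \<kappa> w H)"
proof -
  have \<kappa>s: "\<kappa> a b = \<kappa> b a" "\<kappa> a b * \<kappa> a b = 1" for a b
    using \<kappa> by (auto simp: commutation_factor_def)
  have "unshuffle_sum \<kappa> (z @ a # b # w) H = \<kappa> a b * unshuffle_sum \<kappa> (z @ b # a # w) H" for z a b w
    using assms(2,3)
  proof (induction z arbitrary: H)
    case Nil
    have L: "H (a # b # u) v = \<kappa> a b * H (b # a # u) v" for u v
      using graded_symmetric_swap[OF Nil(1), of "[]" a b u] by simp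
    have R: "H u (a # b # v) = \<kappa> a b * H u (b # a # v)" for u v
      using graded_symmetric_swap[OF Nil(2), of u "[]" a b v] by simp
    have 1: "unshuffle_sum \<kappa> w (\<lambda>u v. H (a # b # u) v)
        = \<kappa> a b * unshuffle_sum \<kappa> w (\<lambda>u v. H (b # a # u) v)"
      by (simp add: L unshuffle_sum_scale)
    have 2: "unshuffle_sum \<kappa> w (\<lambda>u v. pass_factor \<kappa> b u * (pass_factor \<kappa> a u * H u (a # b # v)))
        = \<kappa> a b * unshuffle_sum \<kappa> w (\<lambda>u v. pass_factor \<kappa> a u * (pass_factor \<kappa> b u * H u (b # a # v)))"
      unfolding unshuffle_sum_scale[symmetric] by (simp add: R algebra_simps)
    have 3: "unshuffle_sum \<kappa> w (\<lambda>u v. \<kappa> a b * pass_factor \<kappa> a u * H (b # u) (a # v))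
        = \<kappa> a b * unshuffle_sum \<kappa> w (\<lambda>u v. pass_factor \<kappa> a u * H (b # u) (a # v))"
      unfolding unshuffle_sum_scale[symmetric] by (simp add: algebra_simps)
    have "\<kappa> a b * (\<kappa> b a * y) = y" for y
      using \<kappa>s[of a b] by (simp add: mult.assoc[symmetric])
    then have 4: "unshuffle_sum \<kappa> w (\<lambda>u v. pass_factor \<kappa> b u * H (a # u) (b # v))
        = \<kappa> a b * unshuffle_sum \<kappa> w (\<lambda>u v. \<kappa> b a * pass_factor \<kappa> b u * H (a # u) (b # v))"
      unfolding unshuffle_sum_scale[symmetric] by (simp add: mult.assoc)
    show ?case using 1 2 3 4 by (simp add: algebra_simps)
  next
    case (Cons x z)
    have "unshuffle_sum \<kappa> (z @ a # b # w) (\<lambda>u v. H (x # u) v)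
        = \<kappa> a b * unshuffle_sum \<kappa> (z @ b # a # w) (\<lambda>u v. H (x # u) v)"
      using Cons.prems by (intro Cons.IH) (auto intro: graded_symmetric_Cons)
    moreover have "unshuffle_sum \<kappa> (z @ a # b # w) (\<lambda>u v. pass_factor \<kappa> x u * H u (x # v))
        = \<kappa> a b * unshuffle_sum \<kappa> (z @ b # a # w) (\<lambda>u v. pass_factor \<kappa> x u * H u (x # v))"
    proof (rule Cons.IH)
      show "graded_symmetric \<kappa> (\<lambda>u. pass_factor \<kappa> x u * H u (x # v))" for v
        by (intro graded_symmetric_pass_mult Cons.prems)
      show "graded_symmetric \<kappa> (\<lambda>v. pass_factor \<kappa> x u * H u (x # v))" for u
        by (intro graded_symmetric_scale graded_symmetric_Cons Cons.prems)
    qed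
    ultimately show ?case by (simp add: algebra_simps)
  qed
  then show ?thesis unfolding graded_symmetric_def by blast
qed

text \<open>For graded-symmetric \<open>F\<close> every unshuffle of \<open>w\<close> into \<open>u\<close> and \<open>v\<close> turns \<open>F w\<close> into \<open>F (u @ v)\<close> and the
  signs cancel. A given pair of subwords of lengths \<open>p\<close> and \<open>k - p\<close> arises once for each choice of the \<open>p\<close>
  positions of \<open>u\<close>, which accounts for the binomial coefficient; in the induction it appears
  through the Pascal recursion, according to the part that receives the first letter.\<close>

lemma sum_words_unshuffle_sum:
  fixes F :: "'a list \<Rightarrow> 'k::comm_ring_1"
  assumes \<kappa>: "commutation_factor \<kappa>" and "finite X" and "graded_symmetric \<kappa> F"
  shows "(\<Sum>w\<in>words X k. F w * unshuffle_sum \<kappa> w H)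
    = (\<Sum>p\<le>k. of_nat (k choose p) * (\<Sum>u\<in>words X p. \<Sum>v\<in>words X (k - p). H u v * F (u @ v)))"
  using assms(3)
proof (induction k arbitrary: F H)
  case (Suc k)
  define E where "E p q = (\<Sum>u\<in>words X p. \<Sum>v\<in>words X q. H u v * F (u @ v))" for p q
  have E1: "E (Suc p) q = (\<Sum>x\<in>X. \<Sum>u\<in>words X p. \<Sum>v\<in>words X q. H (x # u) v * F (x # u @ v))" for p q
    unfolding E_def sum_words_Suc by simp
  have move: "H u (x # v) * F (u @ x # v) = pass_factor \<kappa> x u * H u (x # v) * F (x # u @ v)" for u v x
    using graded_symmetric_move[OF \<kappa> Suc.prems, of "[]" u x v] by (simp add: algebra_simps)
  have E2: "E p (Suc q) = (\<Sum>x\<in>X. \<Sum>u\<in>words X p. \<Sum>v\<in>words X q.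
      pass_factor \<kappa> x u * H u (x # v) * F (x # u @ v))" for p q
  proof -
    have "E p (Suc q) = (\<Sum>u\<in>words X p. \<Sum>x\<in>X. \<Sum>v\<in>words X q. H u (x # v) * F (u @ x # v))"
      unfolding E_def sum_words_Suc ..
    also have "\<dots> = (\<Sum>x\<in>X. \<Sum>u\<in>words X p. \<Sum>v\<in>words X q. H u (x # v) * F (u @ x # v))"
      by (rule sum.swap)
    finally show ?thesis by (simp only: move)
  qed
  have IH: "(\<Sum>w\<in>words X k. F (x # w) * unshuffle_sum \<kappa> w H')
    = (\<Sum>p\<le>k. of_nat (k choose p) * (\<Sum>u\<in>words X p. \<Sum>v\<in>words X (k - p). H' u v * F (x # u @ v)))" for x H'
    by (rule Suc.IH) (rule graded_symmetric_Cons[OF Suc.prems])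
  have "(\<Sum>w\<in>words X (Suc k). F w * unshuffle_sum \<kappa> w H)
    = (\<Sum>x\<in>X. (\<Sum>w\<in>words X k. F (x # w) * unshuffle_sum \<kappa> w (\<lambda>u v. H (x # u) v))
        + (\<Sum>w\<in>words X k. F (x # w) * unshuffle_sum \<kappa> w (\<lambda>u v. pass_factor \<kappa> x u * H u (x # v))))"
    by (simp add: sum_words_Suc algebra_simps sum.distrib)
  also have "\<dots> = (\<Sum>x\<in>X. \<Sum>p\<le>k. of_nat (k choose p) * (\<Sum>u\<in>words X p. \<Sum>v\<in>words X (k - p). H (x # u) v * F (x # u @ v)))
       + (\<Sum>x\<in>X. \<Sum>p\<le>k. of_nat (k choose p) * (\<Sum>u\<in>words X p. \<Sum>v\<in>words X (k - p). pass_factor \<kappa> x u * H u (x # v) * F (x # u @ v)))"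
    by (simp only: IH sum.distrib)
  also have "\<dots> = (\<Sum>p\<le>k. of_nat (k choose p) * E (Suc p) (k - p)) + (\<Sum>p\<le>k. of_nat (k choose p) * E p (Suc (k - p)))"
    by (subst (1 2) sum.swap) (simp add: E1 E2 sum_distrib_left)
  also have "(\<Sum>p\<le>k. of_nat (k choose p) * E p (Suc (k - p)))
      = (\<Sum>p\<le>Suc k. of_nat (k choose p) * E p (Suc k - p))"
    by (simp add: Suc_diff_le binomial_eq_0)
  also have "\<dots> = E 0 (Suc k) + (\<Sum>p\<le>k. of_nat (k choose Suc p) * E (Suc p) (k - p))"
    by (subst sum.atMost_Suc_shift) simp
  also have "(\<Sum>p\<le>k. of_nat (k choose p) * E (Suc p) (k - p)) + \<dots>
      = E 0 (Suc k) + (\<Sum>p\<le>k. of_nat (Suc k choose Suc p) * E (Suc p) (k - p))"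
    by (simp add: algebra_simps sum.distrib)
  also have "\<dots> = (\<Sum>p\<le>Suc k. of_nat (Suc k choose p) * E p (Suc k - p))"
    by (subst sum.atMost_Suc_shift) simp
  finally show ?case by (simp only: E_def)
qed simp

text \<open>If a sign-valued function \<open>F\<close> of words transforms by the quotient of two commutation factors,
  multiplying the summands by \<open>F\<close> exchanges one factor for the other. This converts the Koszul signs of
  the generators \<open>\<theta>\<^sup>\<alpha>\<close> into the signs \<open>\<epsilon>\<^sub>\<sigma>\<close> of the Jacobi identity. The prefix \<open>z\<close> holds the letters
  already processed.\<close>

lemma unshuffle_sum_twist:
  assumes "commutation_factor \<kappa>" "commutation_factor \<kappa>'"
    and F: "graded_symmetric (\<lambda>a b. \<kappa> a b * \<kappa>' a b) F"
  shows "unshuffle_sum \<kappa> w (\<lambda>u v. F (z @ u @ v) * H u v) = F (z @ w) * unshuffle_sum \<kappa>' w H"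
proof (induction w arbitrary: z H)
  case (Cons x w)
  have prod: "commutation_factor (\<lambda>a b. \<kappa> a b * \<kappa>' a b)"
    unfolding commutation_factor_def
  proof (intro allI conjI)
    fix a b
    have sq: "\<kappa> a b * \<kappa> a b = 1" "\<kappa>' a b * \<kappa>' a b = 1"
      using assms(1,2) by (auto simp: commutation_factor_def)
    have "\<kappa> a b * \<kappa>' a b * (\<kappa> a b * \<kappa>' a b) = (\<kappa> a b * \<kappa> a b) * (\<kappa>' a b * \<kappa>' a b)"
      by (simp add: algebra_simps)
    then show "\<kappa> a b * \<kappa>' a b * (\<kappa> a b * \<kappa>' a b) = 1"
      using sq by simp
    show "\<kappa> a b * \<kappa>' a b = \<kappa> b a * \<kappa>' b a"
      using assms(1,2)[unfolded commutation_factor_def, rule_format, of a b] by simp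
  qed
  have pf: "pass_factor (\<lambda>a b. \<kappa> a b * \<kappa>' a b) x u = pass_factor \<kappa> x u * pass_factor \<kappa>' x u" for u
    by (induction u) (simp_all add: algebra_simps)
  have F': "pass_factor \<kappa> x u * (F (z @ u @ x # v) * y) = F (z @ x # u @ v) * (pass_factor \<kappa>' x u * y)" for u v y
  proof -
    have "pass_factor \<kappa> x u * (F (z @ u @ x # v) * y)
        = (pass_factor \<kappa> x u * pass_factor \<kappa> x u) * (F (z @ x # u @ v) * (pass_factor \<kappa>' x u * y))"
      by (simp add: graded_symmetric_move[OF prod F, of z u x v] pf algebra_simps)
    then show ?thesis using pass_factor_square[OF assms(1)] by simp
  qed
  have "unshuffle_sum \<kappa> w (\<lambda>u v. F (z @ x # u @ v) * K u v) = F (z @ x # w) * unshuffle_sum \<kappa>' w K" for K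
    using Cons.IH[of "z @ [x]" K] by simp
  then show ?case by (simp add: F' distrib_left)
qed simp

section \<open>Unshuffles as permutations\<close>

text \<open>The sign of moving the letters at the positions \<open>I\<close> in front of those at the positions \<open>J\<close>:
  each \<open>p \<in> I\<close> passes the smaller elements of \<open>J\<close>.\<close>

definition crossing_factor :: "(nat \<Rightarrow> nat \<Rightarrow> 'k::comm_ring_1) \<Rightarrow> nat set \<Rightarrow> nat set \<Rightarrow> 'k" where
  "crossing_factor \<kappa> I J = (\<Prod>p\<in>I. \<Prod>q\<in>{q\<in>J. q < p}. \<kappa> q p)"

lemma sorted_list_of_set_insert_least:
  fixes b :: nat
  assumes "finite S" "\<forall>s\<in>S. b < s"
  shows "sorted_list_of_set (insert b S) = b # sorted_list_of_set S"
proof -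
  have "b \<notin> S" using assms(2) by auto
  then have "sorted_list_of_set (insert b S) = insort b (sorted_list_of_set S)"
    using assms(1) by simp
  also have "\<dots> = b # sorted_list_of_set S"
    by (rule insort_is_Cons) (use assms in \<open>auto simp: less_imp_le\<close>)
  finally show ?thesis .
qed

lemma crossing_factor_insert_left:
  assumes "finite I" "\<forall>s\<in>I \<union> J. b < s"
  shows "crossing_factor \<kappa> (insert b I) J = crossing_factor \<kappa> I J"
proof -
  have "b \<notin> I" using assms by auto
  have "\<not> q < b" if "q \<in> J" for q
    using assms(2) that by (meson UnI2 order.asym)
  then have "{q \<in> J. q < b} = {}" by auto
  then show ?thesis
    by (simp only: crossing_factor_def prod.insert[OF assms(1) \<open>b \<notin> I\<close>] prod.empty mult_1_left)
qed

lemma crossing_factor_insert_right: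
  assumes "finite I" "finite J" "\<forall>s\<in>I \<union> J. b < s"
  shows "crossing_factor \<kappa> I (insert b J)
    = pass_factor \<kappa> b (sorted_list_of_set I) * crossing_factor \<kappa> I J"
proof -
  have "(\<Prod>q\<in>{q \<in> insert b J. q < p}. \<kappa> q p) = \<kappa> b p * (\<Prod>q\<in>{q \<in> J. q < p}. \<kappa> q p)"
    if "p \<in> I" for p
  proof -
    have "{q \<in> insert b J. q < p} = insert b {q \<in> J. q < p}" "b \<notin> {q \<in> J. q < p}"
      using assms that by auto
    then show ?thesis using assms(2) by simp
  qed
  then have "crossing_factor \<kappa> I (insert b J) = (\<Prod>p\<in>I. \<kappa> b p) * crossing_factor \<kappa> I J"
    by (simp add: crossing_factor_def prod.distrib)
  also have "(\<Prod>p\<in>I. \<kappa> b p) = pass_factor \<kappa> b (sorted_list_of_set I)"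
    unfolding pass_factor_def
    using prod.distinct_set_conv_list[of "sorted_list_of_set I" "\<kappa> b"] assms(1) by simp
  finally show ?thesis .
qed

lemma pass_factor_map: "pass_factor \<kappa> (a x) (map a u) = pass_factor (\<lambda>p q. \<kappa> (a p) (a q)) x u"
  by (simp add: pass_factor_def comp_def)

text \<open>An unshuffle is the same as the set \<open>I\<close> of positions of the letters of the first part. The
  induction removes the least position, in accordance with the recursion for \<open>unshuffle_sum\<close>.\<close>

lemma unshuffle_sum_subsets:
  fixes a :: "nat \<Rightarrow> 'a" and \<kappa> :: "'a \<Rightarrow> 'a \<Rightarrow> 'k::comm_ring_1"
  assumes "finite S"
  shows "unshuffle_sum \<kappa> (map a (sorted_list_of_set S)) H
    = (\<Sum>I\<in>Pow S. crossing_factor (\<lambda>p q. \<kappa> (a p) (a q)) I (S - I)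
        * H (map a (sorted_list_of_set I)) (map a (sorted_list_of_set (S - I))))"
  using assms
proof (induction S arbitrary: H rule: finite_linorder_min_induct)
  case empty
  then show ?case by (simp add: crossing_factor_def)
next
  case (insert b S)
  let ?\<kappa> = "\<lambda>p q. \<kappa> (a p) (a q)"
  let ?l = "sorted_list_of_set :: nat set \<Rightarrow> nat list"
  have b: "b \<notin> S" using insert by auto
  have fin: "finite I" if "I \<in> Pow S" for I using that insert.hyps(1) finite_subset by auto
  have 1: "crossing_factor ?\<kappa> (insert b I) (insert b S - insert b I)
        * H (map a (?l (insert b I))) (map a (?l (insert b S - insert b I)))
      = crossing_factor ?\<kappa> I (S - I) * H (a b # map a (?l I)) (map a (?l (S - I)))"
    if I: "I \<in> Pow S" for I
  proof -
    have "insert b S - insert b I = S - I" using b by auto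
    moreover have "\<forall>s\<in>I \<union> (S - I). b < s" using I insert.hyps(2) by auto
    ultimately show ?thesis
      using fin[OF I] by (simp add: crossing_factor_insert_left sorted_list_of_set_insert_least
          del: sorted_list_of_set_insert_remove)
  qed
  have 2: "crossing_factor ?\<kappa> I (insert b S - I)
        * H (map a (?l I)) (map a (?l (insert b S - I)))
      = crossing_factor ?\<kappa> I (S - I)
        * (pass_factor \<kappa> (a b) (map a (?l I)) * H (map a (?l I)) (a b # map a (?l (S - I))))"
    if I: "I \<in> Pow S" for I
  proof -
    have "insert b S - I = insert b (S - I)" using b I by auto
    moreover have "\<forall>s\<in>I \<union> (S - I). b < s" using I insert.hyps(2) by auto
    ultimately show ?thesis
      using fin[OF I] insert.hyps(1)
      by (simp add: crossing_factor_insert_right sorted_list_of_set_insert_least pass_factor_map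
          algebra_simps del: sorted_list_of_set_insert_remove)
  qed
  have "Pow S \<inter> insert b ` Pow S = {}" using b by auto
  moreover have "inj_on (insert b) (Pow S)" using b by (auto simp: inj_on_def)
  ultimately have "(\<Sum>I\<in>Pow (insert b S). f I) = (\<Sum>I\<in>Pow S. f (insert b I)) + (\<Sum>I\<in>Pow S. f I)"
    for f :: "nat set \<Rightarrow> 'k"
    using insert.hyps(1)
    by (simp add: Pow_insert sum.union_disjoint sum.reindex add.commute)
  then have split: "(\<Sum>I\<in>Pow (insert b S). f I) = (\<Sum>I\<in>Pow S. f (insert b I)) + (\<Sum>I\<in>Pow S. f I)"
    for f :: "nat set \<Rightarrow> 'k" .
  show ?case
    unfolding sorted_list_of_set_insert_least[OF insert.hyps] list.map unshuffle_sum.simps insert.IH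
      split
    by (rule arg_cong2[of _ _ _ _ "(+)"], rule sum.cong[OF refl 1[symmetric]], assumption,
        rule sum.cong[OF refl 2[symmetric]], assumption)
qed

text \<open>Sorting the concatenation of two increasing words needs exactly the exchanges counted by
  \<open>crossing_factor\<close>. Applied to the sign of permutations this replaces a count of inversions.\<close>

lemma graded_symmetric_unsort:
  fixes \<kappa> :: "nat \<Rightarrow> nat \<Rightarrow> 'k::comm_ring_1"
  assumes "finite S" "commutation_factor \<kappa>" "graded_symmetric \<kappa> F" "I \<subseteq> S"
  shows "F (z @ sorted_list_of_set I @ sorted_list_of_set (S - I))
    = crossing_factor \<kappa> I (S - I) * F (z @ sorted_list_of_set S)"
  using assms(1,4)
proof (induction S arbitrary: z I rule: finite_linorder_min_induct)
  case empty
  then show ?case by (simp add: crossing_factor_def)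
next
  case (insert b S)
  let ?l = "sorted_list_of_set :: nat set \<Rightarrow> nat list"
  have b: "b \<notin> S" using insert by auto
  define I' where "I' = I - {b}"
  have I': "I' \<subseteq> S" "finite I'" and less: "\<forall>s\<in>I' \<union> (S - I'). b < s" "\<forall>s\<in>I'. b < s" "\<forall>s\<in>S-I'. b < s"
    using insert.prems insert.hyps finite_subset by (auto simp: I'_def)
  note IH = insert.IH[OF I'(1)]
  show ?case
  proof (cases "b \<in> I")
    case True
    then have "I = insert b I'" "insert b S - I = S - I'" using b by (auto simp: I'_def)
    then show ?thesis
      using IH[of "z @ [b]"] insert.hyps I' less
      by (simp add: crossing_factor_insert_left sorted_list_of_set_insert_least
          del: sorted_list_of_set_insert_remove)
  next
    case False
    then have "I = I'" "insert b S - I' = insert b (S - I')" using b I'(1) by (auto simp: I'_def)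
    then show ?thesis
      using IH[of "z @ [b]"] insert.hyps I' less
        graded_symmetric_move[OF assms(2,3), of z "?l I'" b "?l (S - I')"]
      by (simp add: crossing_factor_insert_right sorted_list_of_set_insert_least
          del: sorted_list_of_set_insert_remove)
  qed
qed

text \<open>The permutation whose one-line notation is the given word, positions starting at \<open>1\<close>.\<close>

definition word_perm :: "nat list \<Rightarrow> nat \<Rightarrow> nat" where
  "word_perm w = (\<lambda>x. if x \<in> {1..length w} then w ! (x - 1) else x)"

lemma word_perm_permutes:
  assumes "distinct w" "set w = {1..length w}"
  shows "word_perm w permutes {1..length w}"
proof (rule bij_imp_permutes)
  have "bij_betw (\<lambda>x. x - 1) {1..length w} {..<length w}"
    by (rule bij_betw_byWitness[of _ "\<lambda>x. x + 1"]) auto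
  from bij_betw_trans[OF this bij_betw_nth[OF assms(1) refl refl]]
  have "bij_betw ((!) w \<circ> (\<lambda>x. x - 1)) {1..length w} (set w)" by simp
  then show "bij_betw (word_perm w) {1..length w} {1..length w}"
    unfolding assms(2)[symmetric]
    by (rule bij_betw_cong[THEN iffD1, rotated]) (simp add: word_perm_def assms(2))
qed (auto simp: word_perm_def)

text \<open>Exchanging adjacent letters composes the permutation with a transposition, so the sign of a
  permutation is a graded-symmetric function of its one-line notation for the constant sign
  \<open>-1\<close> and can be computed by sorting.\<close>

lemma sign_word_perm_unsort:
  assumes "I \<subseteq> {1..k}"
  shows "of_int (sign (word_perm (sorted_list_of_set I @ sorted_list_of_set ({1..k} - I))))
    = crossing_factor (\<lambda>_ _. - 1 :: 'k::comm_ring_1) I ({1..k} - I)"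
proof -
  \<comment> \<open>Extended by \<open>0\<close> to words that are not one-line notations, in particular to those with a
    repeated letter, where graded symmetry demands \<open>F = - F\<close>.\<close>
  define F :: "nat list \<Rightarrow> 'k" where
    "F w = (if distinct w \<and> set w = {1..length w} then of_int (sign (word_perm w)) else 0)" for w
  have cf: "commutation_factor (\<lambda>_ _ :: nat. - 1 :: 'k)" by (simp add: commutation_factor_def)
  have "F (u @ p # q # v) = - 1 * F (u @ q # p # v)" for u p q v
  proof (cases "distinct (u @ p # q # v) \<and> set (u @ p # q # v) = {1..length (u @ p # q # v)}")
    case False
    then have "\<not> (distinct (u @ q # p # v) \<and> set (u @ q # p # v) = {1..length (u @ q # p # v)})"
      by (auto simp: insert_commute)
    with False show ?thesis unfolding F_def by (simp only: if_False mult_zero_right)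
  next
    case True
    let ?w = "u @ p # q # v" and ?w' = "u @ q # p # v"
    have T': "distinct ?w'" "set ?w' = {1..length ?w'}"
      using True by (auto simp: insert_commute)
    let ?t = "transpose (length u + 1) (length u + 2)"
    have "word_perm ?w = word_perm ?w' \<circ> ?t"
    proof
      fix x
      consider "x = length u + 1" | "x = length u + 2" | "x \<le> length u" | "x > length u + 2" by linarith
      then show "word_perm ?w x = (word_perm ?w' \<circ> ?t) x"
      proof cases
        case 4
        then obtain y where "x = length u + 3 + y" by (metis less_iff_Suc_add add_Suc_right add_Suc numeral_3_eq_3 add_2_eq_Suc' add_0)
        then show ?thesis by (simp add: word_perm_def nth_append)
      qed (auto simp: word_perm_def nth_append)
    qed
    moreover have "permutation (word_perm ?w')"
      using word_perm_permutes[OF T'] permutes_imp_permutation by blast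
    ultimately have "sign (word_perm ?w) = - sign (word_perm ?w')"
      by (simp add: sign_compose permutation_swap_id sign_swap_id)
    with True T' show ?thesis unfolding F_def by simp
  qed
  then have gs: "graded_symmetric (\<lambda>_ _. - 1) F" unfolding graded_symmetric_def by blast
  let ?w = "sorted_list_of_set I @ sorted_list_of_set ({1..k} - I)"
  have fin: "finite I" using assms finite_subset by blast
  have "set ?w = {1..k}" using assms fin by auto
  moreover have "distinct ?w" using fin by auto
  ultimately have "F ?w = of_int (sign (word_perm ?w))"
    unfolding F_def using distinct_card[of ?w] by simp
  moreover have "word_perm (sorted_list_of_set {1..k}) = id"
    by (auto simp: word_perm_def fun_eq_iff atLeastAtMost_upt nth_upt simp del: upt_Suc)
  then have "F (sorted_list_of_set {1..k}) = 1" by (simp add: F_def)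
  ultimately show ?thesis
    using graded_symmetric_unsort[OF _ cf gs assms, of "[]"] by simp
qed

lemma map_upt_strict_mono:
  assumes "strict_mono_on {m..<n} \<sigma>"
  shows "map \<sigma> [m..<n] = sorted_list_of_set (\<sigma> ` {m..<n} :: nat set)"
proof -
  have "sorted_wrt (<) (map \<sigma> [m..<n])"
    unfolding sorted_wrt_map
    by (rule sorted_wrt_mono_rel[OF _ sorted_wrt_upt])
      (use assms in \<open>auto simp: strict_mono_on_def\<close>)
  then have "sorted_list_of_set (set (map \<sigma> [m..<n])) = map \<sigma> [m..<n]"
    by (intro sorted_list_of_set.idem_if_sorted_distinct) (auto simp: strict_sorted_iff)
  then show ?thesis by simp
qed

lemma unshuffle_lists:
  assumes "\<sigma> \<in> unshuffles p j"
  defines "I \<equiv> \<sigma> ` {1..p}"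
  shows "map \<sigma> [1..<p+1] = sorted_list_of_set I"
    and "map \<sigma> [p+1..<p+j+1] = sorted_list_of_set ({1..p+j} - I)"
    and "I \<subseteq> {1..p+j}" and "card I = p"
    and "\<sigma> ` {p+1..p+j} = {1..p+j} - I"
proof -
  have \<sigma>: "\<sigma> permutes {1..p+j}" "strict_mono_on {1..p} \<sigma>" "strict_mono_on {p+1..p+j} \<sigma>"
    using assms by (auto simp: unshuffles_def)
  have e: "{1..p} = {1..<p+1}" "{p+1..p+j} = {p+1..<p+j+1}" by auto
  show "map \<sigma> [1..<p+1] = sorted_list_of_set I"
    unfolding I_def e by (rule map_upt_strict_mono) (use \<sigma>(2) e in simp)
  have "{p+1..p+j} = {1..p+j} - {1..p}" by auto
  then show C: "\<sigma> ` {p+1..p+j} = {1..p+j} - I"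
    using permutes_image[OF \<sigma>(1)] image_set_diff[OF permutes_inj[OF \<sigma>(1)]] by (simp add: I_def)
  show "map \<sigma> [p+1..<p+j+1] = sorted_list_of_set ({1..p+j} - I)"
    unfolding C[symmetric] e by (rule map_upt_strict_mono) (use \<sigma>(3) e in simp)
  have "\<sigma> ` {1..p} \<subseteq> \<sigma> ` {1..p+j}" by (rule image_mono) auto
  then show "I \<subseteq> {1..p+j}" using permutes_image[OF \<sigma>(1)] by (simp add: I_def)
  show "card I = p" using card_image[OF permutes_inj_on[OF \<sigma>(1), of "{1..p}"]] by (simp add: I_def)
qed

lemma word_perm_unshuffle:
  assumes "I \<subseteq> {1..p+j}" "card I = p"
  defines "\<sigma> \<equiv> word_perm (sorted_list_of_set I @ sorted_list_of_set ({1..p+j} - I))"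
  shows "\<sigma> \<in> unshuffles p j" "\<sigma> ` {1..p} = I"
proof -
  let ?u = "sorted_list_of_set I" and ?v = "sorted_list_of_set ({1..p+j} - I)"
  have fin: "finite I" using assms(1) finite_subset by blast
  have card: "card ({1..p+j} - I) = j" using assms fin by (simp add: card_Diff_subset)
  have len: "length ?u = p" "length ?v = j" using assms(2) card by simp_all
  have "set (?u @ ?v) = {1..p+j}" using assms(1) fin by auto
  moreover have "distinct (?u @ ?v)" using fin by auto
  ultimately have "\<sigma> permutes {1..p+j}"
    using word_perm_permutes[of "?u @ ?v"] len by (simp add: \<sigma>_def)
  moreover have 1: "\<sigma> x = ?u ! (x - 1)" if "x \<in> {1..p}" for x
    using that len by (auto simp: \<sigma>_def word_perm_def nth_append)
  moreover have 2: "\<sigma> x = ?v ! (x - p - 1)" if "x \<in> {p+1..p+j}" for x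
    using that len by (auto simp: \<sigma>_def word_perm_def nth_append)
  moreover have "strict_mono_on {1..p} \<sigma>"
    unfolding strict_mono_on_def
    using 1 sorted_wrt_nth_less[OF strict_sorted_list_of_set[of I]] len by auto
  moreover have "strict_mono_on {p+1..p+j} \<sigma>"
    unfolding strict_mono_on_def
  proof (intro allI impI)
    fix x y assume "x \<in> {p+1..p+j} \<and> y \<in> {p+1..p+j} \<and> x < y"
    then show "\<sigma> x < \<sigma> y"
      using 2 sorted_wrt_nth_less[OF strict_sorted_list_of_set[of "{1..p+j} - I"], of "x - p - 1" "y - p - 1"] len
      by auto
  qed
  ultimately show "\<sigma> \<in> unshuffles p j" by (simp add: unshuffles_def)
  have "\<sigma> ` {1..p} = (\<lambda>x. ?u ! (x - 1)) ` {1..p}" using 1 by (intro image_cong) auto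
  also have "\<dots> = (!) ?u ` {0..<p}"
    unfolding image_image[of "(!) ?u" "\<lambda>x. x - 1", symmetric]
    by (rule arg_cong[of _ _ "\<lambda>S. (!) ?u ` S"]) (force simp: image_iff Bex_def intro: exI[of _ "Suc _"])
  also have "\<dots> = set ?u" using len by (auto simp: set_conv_nth image_def)
  finally show "\<sigma> ` {1..p} = I" using fin by simp
qed

lemma word_perm_map: "\<sigma> permutes {1..k} \<Longrightarrow> word_perm (map \<sigma> [1..<k+1]) = \<sigma>"
  by (auto simp: word_perm_def fun_eq_iff permutes_not_in simp del: upt_Suc)

text \<open>An inversion of an unshuffle is a pair consisting of a position \<open>\<le> p\<close> and a position \<open>> p\<close>, because
  the permutation increases on both blocks; its values are an element of \<open>I\<close> and a smaller element
  of the complement. Both factors of \<open>\<epsilon>\<^sub>\<sigma>\<close> are products over these pairs.\<close>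

lemma perm_sign_unshuffle:
  assumes \<sigma>: "\<sigma> \<in> unshuffles p j"
  defines "I \<equiv> \<sigma> ` {1..p}"
  shows "perm_sign (p + j) e \<sigma>
    = crossing_factor (\<lambda>x y. - ((-1 :: 'k::field) powi (e x * e y))) I ({1..p+j} - I)"
proof -
  let ?C = "{1..p+j} - I"
  have \<sigma>': "\<sigma> permutes {1..p+j}" "strict_mono_on {1..p} \<sigma>" "strict_mono_on {p+1..p+j} \<sigma>"
    using \<sigma> by (auto simp: unshuffles_def)
  note l = unshuffle_lists[OF \<sigma>, folded I_def]
  have "[1..<p+j+1] = [1..<p+1] @ [p+1..<p+j+1]"
    using upt_add_eq_append[of 1 "p+1" j] by (simp add: algebra_simps)
  then have "map \<sigma> [1..<p+j+1] = sorted_list_of_set I @ sorted_list_of_set ?C"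
    using l(1,2) by (simp only: map_append)
  then have "sign \<sigma> = sign (word_perm (sorted_list_of_set I @ sorted_list_of_set ?C))"
    using word_perm_map[OF \<sigma>'(1)] by simp
  then have sgn: "of_int (sign \<sigma>) = crossing_factor (\<lambda>_ _. - 1 :: 'k) I ?C"
    using sign_word_perm_unsort[OF l(3)] by simp
  let ?inv = "{(q, r). 1 \<le> q \<and> q < r \<and> r \<le> p + j \<and> \<sigma> q > \<sigma> r}"
  have mem: "q \<in> {1..p}" "r \<in> {p+1..p+j}" if "1 \<le> q" "q < r" "r \<le> p + j" "\<sigma> q > \<sigma> r" for q r
  proof -
    have "\<not> (q \<in> {1..p} \<and> r \<in> {1..p})" "\<not> (q \<in> {p+1..p+j} \<and> r \<in> {p+1..p+j})"
      using \<sigma>'(2,3) that unfolding strict_mono_on_def by (metis order.asym)+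
    then show "q \<in> {1..p}" "r \<in> {p+1..p+j}" using that by auto
  qed
  have inv: "inv \<sigma> (\<sigma> x) = x" "\<sigma> (inv \<sigma> x) = x" for x
    using permutes_inverses[OF \<sigma>'(1)] by auto
  have "(\<Prod>(q, r)\<in>?inv. (-1 :: 'k) powi (e (\<sigma> q) * e (\<sigma> r)))
      = (\<Prod>(x, y)\<in>(SIGMA x:I. {y\<in>?C. y < x}). (-1) powi (e x * e y))"
  proof (rule prod.reindex_bij_witness[of _ "\<lambda>(x, y). (inv \<sigma> x, inv \<sigma> y)" "\<lambda>(q, r). (\<sigma> q, \<sigma> r)"])
    fix z assume "z \<in> ?inv"
    then obtain q r where z: "z = (q, r)" "1 \<le> q" "q < r" "r \<le> p + j" "\<sigma> q > \<sigma> r" by auto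
    then have "\<sigma> q \<in> I" "\<sigma> r \<in> ?C" using mem[of q r] l(5) by (auto simp only: I_def)
    with z show "(\<lambda>(q, r). (\<sigma> q, \<sigma> r)) z \<in> (SIGMA x:I. {y\<in>?C. y < x})" by simp
  next
    fix z assume "z \<in> (SIGMA x:I. {y\<in>?C. y < x})"
    then obtain x y where z: "z = (x, y)" "x \<in> I" "y \<in> ?C" "y < x" by auto
    from z(2) obtain q where "x = \<sigma> q" "q \<in> {1..p}" by (auto simp: I_def)
    moreover from z(3) have "y \<in> \<sigma> ` {p+1..p+j}" by (simp only: l(5))
    then obtain r where "y = \<sigma> r" "r \<in> {p+1..p+j}" by auto
    ultimately show "(\<lambda>(x, y). (inv \<sigma> x, inv \<sigma> y)) z \<in> ?inv" using z by (auto simp: inv)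
  qed (auto simp: inv)
  also have "\<dots> = crossing_factor (\<lambda>x y. (-1) powi (e x * e y)) I ?C"
    using finite_subset[OF l(3)] unfolding crossing_factor_def
    by (subst prod.Sigma) (auto simp: mult.commute)
  finally show ?thesis
    unfolding perm_sign_def sgn by (simp only: crossing_factor_def prod.distrib[symmetric] mult_minus1)
qed

text \<open>Unshuffles correspond bijectively to the sets \<open>I = \<sigma> ` {1..p}\<close>, and both blocks of values are the
  increasing enumerations of \<open>I\<close> and of its complement.\<close>

lemma sum_unshuffles:
  fixes H :: "'a list \<Rightarrow> 'a list \<Rightarrow> 'k::field"
  shows "(\<Sum>\<sigma>\<in>unshuffles p j. perm_sign (p + j) e \<sigma>
      * H (map (\<lambda>q. a (\<sigma> q)) [1..<p+1]) (map (\<lambda>q. a (\<sigma> q)) [p+1..<p+j+1]))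
    = (\<Sum>I | I \<subseteq> {1..p+j} \<and> card I = p.
      crossing_factor (\<lambda>x y. - ((-1) powi (e x * e y))) I ({1..p+j} - I)
      * H (map a (sorted_list_of_set I)) (map a (sorted_list_of_set ({1..p+j} - I))))"
proof (rule sum.reindex_bij_witness[of _
      "\<lambda>I. word_perm (sorted_list_of_set I @ sorted_list_of_set ({1..p+j} - I))" "\<lambda>\<sigma>. \<sigma> ` {1..p}"])
  fix \<sigma> assume \<sigma>: "\<sigma> \<in> unshuffles p j"
  note l = unshuffle_lists[OF \<sigma>]
  have "[1..<p+j+1] = [1..<p+1] @ [p+1..<p+j+1]"
    using upt_add_eq_append[of 1 "p+1" j] by (simp add: algebra_simps)
  then have "map \<sigma> [1..<p+j+1]
      = sorted_list_of_set (\<sigma> ` {1..p}) @ sorted_list_of_set ({1..p+j} - \<sigma> ` {1..p})"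
    using l(1,2) by (simp only: map_append)
  then show "word_perm (sorted_list_of_set (\<sigma> ` {1..p}) @ sorted_list_of_set ({1..p+j} - \<sigma> ` {1..p})) = \<sigma>"
    using word_perm_map[of \<sigma> "p + j"] \<sigma> by (simp add: unshuffles_def)
  show "\<sigma> ` {1..p} \<in> {I. I \<subseteq> {1..p+j} \<and> card I = p}" using l(3,4) by simp
  have "map (\<lambda>q. a (\<sigma> q)) [1..<p+1] = map a (sorted_list_of_set (\<sigma> ` {1..p}))"
    "map (\<lambda>q. a (\<sigma> q)) [p+1..<p+j+1] = map a (sorted_list_of_set ({1..p+j} - \<sigma> ` {1..p}))"
    unfolding l(1,2)[symmetric] map_map comp_def by simp_all
  then show "crossing_factor (\<lambda>x y. - ((-1) powi (e x * e y))) (\<sigma> ` {1..p}) ({1..p+j} - \<sigma> ` {1..p})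
      * H (map a (sorted_list_of_set (\<sigma> ` {1..p}))) (map a (sorted_list_of_set ({1..p+j} - \<sigma> ` {1..p})))
    = perm_sign (p + j) e \<sigma>
      * H (map (\<lambda>q. a (\<sigma> q)) [1..<p+1]) (map (\<lambda>q. a (\<sigma> q)) [p+1..<p+j+1])"
    by (simp only: perm_sign_unshuffle[OF \<sigma>])
next
  fix I assume "I \<in> {I. I \<subseteq> {1..p+j} \<and> card I = p}"
  then have "I \<subseteq> {1..p+j}" "card I = p" by simp_all
  from word_perm_unshuffle[OF this]
  show "word_perm (sorted_list_of_set I @ sorted_list_of_set ({1..p+j} - I)) ` {1..p} = I"
    "word_perm (sorted_list_of_set I @ sorted_list_of_set ({1..p+j} - I)) \<in> unshuffles p j"
    by simp_all
qed

section \<open>The graded-commutative algebra\<close>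

lemma finite_submultisets: "finite {P. P \<subseteq># M}"
proof (induction M)
  case (add x M)
  have "{P. P \<subseteq># add_mset x M} \<subseteq> {P. P \<subseteq># M} \<union> add_mset x ` {P. P \<subseteq># M}"
  proof
    fix P assume P: "P \<in> {P. P \<subseteq># add_mset x M}"
    show "P \<in> {P. P \<subseteq># M} \<union> add_mset x ` {P. P \<subseteq># M}"
    proof (cases "x \<in># P")
      case True
      then obtain P' where "P = add_mset x P'" by (metis insert_DiffM)
      with P show ?thesis by auto
    next
      case False
      have "P \<subseteq># M"
      proof (rule mset_subset_eqI)
        show "count P a \<le> count M a" for a
          using mset_subset_eq_count[of P "add_mset x M" a] P False by (auto simp: not_in_iff split: if_splits)
      qed
      then show ?thesis by simp
    qed
  qed
  then show ?case by (rule finite_subset) (use add in simp)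
qed simp

definition monomial :: "nat multiset \<Rightarrow> nat multiset \<Rightarrow> 'k::field" where
  "monomial N = (\<lambda>M. if M = N then 1 else 0)"

text \<open>For \<open>p = 1\<close> this is the parity automorphism \<open>f \<mapsto> (-1)\<^bsup>|f|\<^esup> f\<close>. With it the graded Leibniz law
  reads \<open>\<delta>(fg) = \<delta>(f) g + f' \<delta>(g)\<close>, where \<open>f'\<close> is the twist of \<open>f\<close>, for all \<open>f\<close> and \<open>g\<close>, homogeneous or not.
  General \<open>p\<close> gives the sign of commuting with an element of parity \<open>p\<close>.\<close>

definition parity_twist :: "(nat \<Rightarrow> int) \<Rightarrow> int \<Rightarrow> (nat multiset \<Rightarrow> 'k::field) \<Rightarrow> (nat multiset \<Rightarrow> 'k)" where
  "parity_twist d p f = (\<lambda>M. (-1) powi (p * ce_deg d M) * f M)"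

definition has_parity :: "(nat \<Rightarrow> int) \<Rightarrow> int \<Rightarrow> (nat multiset \<Rightarrow> 'k::field) \<Rightarrow> bool" where
  "has_parity d p f \<longleftrightarrow> (\<forall>M. f M \<noteq> 0 \<longrightarrow> even (ce_deg d M - p))"

abbreviation word_deg :: "(nat \<Rightarrow> int) \<Rightarrow> nat list \<Rightarrow> int" where
  "word_deg e w \<equiv> (\<Sum>\<alpha>\<leftarrow>w. e \<alpha>)"

definition theta_commutation :: "(nat \<Rightarrow> int) \<Rightarrow> nat \<Rightarrow> nat \<Rightarrow> 'k::field" where
  "theta_commutation d a b = (-1) powi (theta_deg d a * theta_deg d b)"

lemma commutation_factor_theta: "commutation_factor (theta_commutation d)"
  by (simp add: commutation_factor_def theta_commutation_def mult.commute minus_one_powi_square)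

definition skew_commutation :: "(nat \<Rightarrow> int) \<Rightarrow> nat \<Rightarrow> nat \<Rightarrow> 'k::field" where
  "skew_commutation d a b = - ((-1) powi (d a * d b))"

lemma commutation_factor_skew: "commutation_factor (skew_commutation d)"
  by (simp add: commutation_factor_def skew_commutation_def mult.commute minus_one_powi_square)

lemma ce_monomial_mono: "ce_monomial n d M \<Longrightarrow> P \<subseteq># M \<Longrightarrow> ce_monomial n d P"
  unfolding ce_monomial_def
  by (meson mset_subset_eq_count order_trans set_mset_mono)

lemma ce_deg_simps [simp]:
  "ce_deg d {#} = 0" "ce_deg d (add_mset a M) = theta_deg d a + ce_deg d M"
  "ce_deg d (P + Q) = ce_deg d P + ce_deg d Q"
  by (simp_all add: ce_deg_def)

lemma ce_deg_mset: "ce_deg d (mset w) = word_deg (theta_deg d) w"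
  by (induction w) simp_all

lemma ce_sign_empty [simp]: "ce_sign d {#} Q = 1" "ce_sign d P {#} = 1"
  by (simp_all add: ce_sign_def)

lemma ce_sign_add_left: "ce_sign d (P + P') Q = (ce_sign d P Q * ce_sign d P' Q :: 'k::field)"
  by (simp add: ce_sign_def power_int_add)

lemma ce_sign_add_right: "ce_sign d P (Q + Q') = (ce_sign d P Q * ce_sign d P Q' :: 'k::field)"
  by (simp add: ce_sign_def power_int_add sum_mset.distrib)

text \<open>A pair of different letters, one in \<open>P\<close> and one in \<open>Q\<close>, is counted in exactly one of the two
  inversion sums and once in the product of the degrees. Equal letters occur in the latter only;
  they contribute the square of a degree, which is even because a monomial does not repeat
  generators of odd degree.\<close>

lemma even_inversion_parity:
  assumes "ce_monomial n d (P + Q)"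
  shows "even ((\<Sum>\<alpha>\<in>#P. \<Sum>\<beta>\<in>#{#\<beta> \<in># Q. \<beta> < \<alpha>#}. theta_deg d \<alpha> * theta_deg d \<beta>)
    + (\<Sum>\<alpha>\<in>#Q. \<Sum>\<beta>\<in>#{#\<beta> \<in># P. \<beta> < \<alpha>#}. theta_deg d \<alpha> * theta_deg d \<beta>)
    + ce_deg d P * ce_deg d Q)"
  using assms
proof (induction P)
  case empty
  then show ?case by simp
next
  case (add a P)
  let ?e = "theta_deg d"
  have "even ((\<Sum>\<beta>\<in>#{#\<beta> \<in># Q. \<beta> < a#}. ?e a * ?e \<beta>)
      + (\<Sum>\<alpha>\<in>#Q. if a < \<alpha> then ?e \<alpha> * ?e a else 0) + ?e a * ce_deg d Q)"
    using add.prems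
  proof (induction Q)
    case empty
    then show ?case by simp
  next
    case (add b Q)
    have "ce_monomial n d (add_mset a P + Q)"
      by (rule ce_monomial_mono[OF add.prems]) simp
    note IH = add.IH[OF this]
    have "even (?e a)" if "a = b"
    proof (rule ccontr)
      assume "odd (?e a)"
      then have "count (add_mset a P + add_mset b Q) a \<le> 1"
        using add.prems unfolding ce_monomial_def by blast
      with that show False by simp
    qed
    with IH show ?case by (cases a b rule: linorder_cases) (auto simp: algebra_simps)
  qed
  moreover have "ce_monomial n d (P + Q)"
    by (rule ce_monomial_mono[OF add.prems]) simp
  note add.IH[OF this]
  moreover have "(\<Sum>\<alpha>\<in>#Q. \<Sum>\<beta>\<in>#{#\<beta> \<in># add_mset a P. \<beta> < \<alpha>#}. ?e \<alpha> * ?e \<beta>)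
     = (\<Sum>\<alpha>\<in>#Q. if a < \<alpha> then ?e \<alpha> * ?e a else 0) + (\<Sum>\<alpha>\<in>#Q. \<Sum>\<beta>\<in>#{#\<beta> \<in># P. \<beta> < \<alpha>#}. ?e \<alpha> * ?e \<beta>)"
    by (subst sum_mset.distrib[symmetric]) (auto intro!: arg_cong[of _ _ sum_mset] image_mset_cong)
  moreover have "(\<Sum>\<alpha>\<in>#add_mset a P. \<Sum>\<beta>\<in>#{#\<beta> \<in># Q. \<beta> < \<alpha>#}. ?e \<alpha> * ?e \<beta>)
     = (\<Sum>\<beta>\<in>#{#\<beta> \<in># Q. \<beta> < a#}. ?e a * ?e \<beta>) + (\<Sum>\<alpha>\<in>#P. \<Sum>\<beta>\<in>#{#\<beta> \<in># Q. \<beta> < \<alpha>#}. ?e \<alpha> * ?e \<beta>)"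
    by simp
  moreover have "even (A + B + C) \<Longrightarrow> even (X + Y + Z) \<Longrightarrow> even ((A + X) + (B + Y) + (C + Z))"
    for A B C X Y Z :: int by presburger
  ultimately show ?case by (simp only: ce_deg_simps distrib_right)
qed

lemma ce_sign_commute:
  assumes "ce_monomial n d (P + Q)"
  shows "ce_sign d P Q = ((-1) powi (ce_deg d P * ce_deg d Q) * ce_sign d Q P :: 'k::field)"
proof -
  have "even (x + y + z) \<Longrightarrow> even (x - (z + y))" for x y z :: int by presburger
  from this[OF even_inversion_parity[OF assms]] show ?thesis
    unfolding ce_sign_def minus_one_powi_mult by (rule minus_one_powi_cong)
qed

text \<open>Both sides are sums over decompositions \<open>M = P + Q + T\<close>, with the same sign since \<open>ce_sign\<close> is
  multiplicative in each argument.\<close>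

lemma ce_mult_assoc:
  "ce_mult n d f (ce_mult n d g h) = ce_mult n d (ce_mult n d f g) (h :: nat multiset \<Rightarrow> 'k::field)"
proof
  fix M
  show "ce_mult n d f (ce_mult n d g h) M = ce_mult n d (ce_mult n d f g) h M"
  proof (cases "ce_monomial n d M")
    case True
    note sub = ce_monomial_mono[OF True]
    have "ce_mult n d f (ce_mult n d g h) M
      = (\<Sum>P | P \<subseteq># M. \<Sum>Q | Q \<subseteq># M - P. ce_sign d P (M - P) * f P
          * (ce_sign d Q (M - P - Q) * g Q * h (M - P - Q)))"
      using True by (simp add: ce_mult_def sub sum_distrib_left)
    also have "\<dots> = (\<Sum>(P, Q)\<in>(SIGMA P:{P. P \<subseteq># M}. {Q. Q \<subseteq># M - P}). ce_sign d P (M - P) * f P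
          * (ce_sign d Q (M - P - Q) * g Q * h (M - P - Q)))"
      by (rule sum.Sigma) (simp_all add: finite_submultisets)
    also have "\<dots> = (\<Sum>(R, P)\<in>(SIGMA R:{R. R \<subseteq># M}. {P. P \<subseteq># R}). ce_sign d R (M - R)
          * (ce_sign d P (R - P) * f P * g (R - P)) * h (M - R))"
    proof (rule sum.reindex_bij_witness[of _ "\<lambda>(R, P). (P, R - P)" "\<lambda>(P, Q). (P + Q, P)"])
      fix z assume "z \<in> (SIGMA P:{P. P \<subseteq># M}. {Q. Q \<subseteq># M - P})"
      then obtain P Q where z: "z = (P, Q)" and PQ: "P \<subseteq># M" "Q \<subseteq># M - P" by auto
      then obtain T where T: "M = P + Q + T"
        by (metis subset_mset.add_diff_inverse add.assoc)
      show "(case case z of (P, Q) \<Rightarrow> (P + Q, P) of (R, P) \<Rightarrow> ce_sign d R (M - R)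
          * (ce_sign d P (R - P) * f P * g (R - P)) * h (M - R))
        = (case z of (P, Q) \<Rightarrow> ce_sign d P (M - P) * f P * (ce_sign d Q (M - P - Q) * g Q * h (M - P - Q)))"
        unfolding z T by (simp add: ce_sign_add_left ce_sign_add_right algebra_simps)
      show "(case z of (P, Q) \<Rightarrow> (P + Q, P)) \<in> (SIGMA R:{R. R \<subseteq># M}. {P. P \<subseteq># R})"
        unfolding z T by simp
    next
      fix z assume "z \<in> (SIGMA R:{R. R \<subseteq># M}. {P. P \<subseteq># R})"
      then obtain R P where z: "z = (R, P)" and RP: "R \<subseteq># M" "P \<subseteq># R" by auto
      then obtain Q T where T: "R = P + Q" "M = P + Q + T"
        by (metis subset_mset.add_diff_inverse)
      show "(case z of (R, P) \<Rightarrow> (P, R - P)) \<in> (SIGMA P:{P. P \<subseteq># M}. {Q. Q \<subseteq># M - P})"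
        "(case case z of (R, P) \<Rightarrow> (P, R - P) of (P, Q) \<Rightarrow> (P + Q, P)) = z"
        unfolding z T by simp_all
    qed auto
    also have "\<dots> = (\<Sum>R | R \<subseteq># M. \<Sum>P | P \<subseteq># R. ce_sign d R (M - R)
          * (ce_sign d P (R - P) * f P * g (R - P)) * h (M - R))"
      by (rule sum.Sigma[symmetric]) (simp_all add: finite_submultisets)
    also have "\<dots> = ce_mult n d (ce_mult n d f g) h M"
      using True by (simp add: ce_mult_def sub sum_distrib_left sum_distrib_right)
    finally show ?thesis .
  qed (simp add: ce_mult_def)
qed

lemma ce_mult_nonmonomial: "\<not> ce_monomial n d M \<Longrightarrow> ce_mult n d f g M = 0"
  by (simp add: ce_mult_def)

lemma ce_mult_monomial_left:
  "ce_mult n d (monomial P) g M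
    = (if ce_monomial n d M \<and> P \<subseteq># M then ce_sign d P (M - P) * g (M - P) else 0)"
proof -
  have "(\<Sum>P' | P' \<subseteq># M. ce_sign d P' (M - P') * monomial P P' * g (M - P'))
      = (\<Sum>P' | P' \<subseteq># M. if P' = P then ce_sign d P (M - P) * g (M - P) else 0)"
    by (rule sum.cong) (auto simp: monomial_def)
  then show ?thesis by (simp add: ce_mult_def finite_submultisets)
qed

lemma ce_one_monomial: "ce_one = monomial {#}"
  by (simp add: ce_one_def monomial_def)

lemma theta_monomial: "theta \<alpha> = monomial {#\<alpha>#}"
  by (simp add: theta_def monomial_def)

lemma ce_mult_one_left:
  assumes "\<And>M. f M \<noteq> 0 \<Longrightarrow> ce_monomial n d M"
  shows "ce_mult n d ce_one f = f"
  using assms by (auto simp: fun_eq_iff ce_one_monomial ce_mult_monomial_left)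

lemma ce_mult_one_right:
  assumes "\<And>M. f M \<noteq> 0 \<Longrightarrow> ce_monomial n d M"
  shows "ce_mult n d f ce_one = f"
proof
  fix M
  have "(\<Sum>P | P \<subseteq># M. ce_sign d P (M - P) * f P * ce_one (M - P))
      = (\<Sum>P | P \<subseteq># M. if P = M then f M else 0)"
    by (rule sum.cong) (auto simp: ce_one_def subset_mset.le_iff_add)
  then show "ce_mult n d f ce_one M = f M"
    using assms[of M] by (auto simp: ce_mult_def finite_submultisets)
qed

lemma ce_mult_add_left:
  "ce_mult n d (\<lambda>M. f M + g M) h = (\<lambda>M. ce_mult n d f h M + ce_mult n d g h M)"
  by (simp add: ce_mult_def fun_eq_iff algebra_simps sum.distrib)

lemma ce_mult_add_right:
  "ce_mult n d h (\<lambda>M. f M + g M) = (\<lambda>M. ce_mult n d h f M + ce_mult n d h g M)"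
  by (simp add: ce_mult_def fun_eq_iff algebra_simps sum.distrib)

lemma ce_mult_scale_left: "ce_mult n d (\<lambda>M. s * f M) g = (\<lambda>M. s * ce_mult n d f g M)"
  by (simp add: ce_mult_def fun_eq_iff sum_distrib_left algebra_simps)

lemma ce_mult_scale_right: "ce_mult n d f (\<lambda>M. s * g M) = (\<lambda>M. s * ce_mult n d f g M)"
  by (simp add: ce_mult_def fun_eq_iff sum_distrib_left algebra_simps)

lemma ce_mult_zero [simp]: "ce_mult n d (\<lambda>M. 0) g = (\<lambda>M. 0)" "ce_mult n d f (\<lambda>M. 0) = (\<lambda>M. 0)"
  by (simp_all add: ce_mult_def fun_eq_iff)

text \<open>Only one factor has to be homogeneous: the other one absorbs the Koszul sign, degree by degree,
  in its twist.\<close>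

lemma ce_mult_commute:
  fixes f g :: "nat multiset \<Rightarrow> 'k::field"
  assumes "has_parity d p f"
  shows "ce_mult n d f g = ce_mult n d (parity_twist d p g) f"
proof
  fix M
  have "(\<Sum>P | P \<subseteq># M. ce_sign d P (M - P) * f P * g (M - P))
      = (\<Sum>P | P \<subseteq># M. ce_sign d P (M - P) * parity_twist d p g P * f (M - P))"
    if M: "ce_monomial n d M"
  proof (rule sum.reindex_bij_witness[of _ "\<lambda>P. M - P" "\<lambda>P. M - P"])
    fix P assume "P \<in> {P. P \<subseteq># M}"
    then obtain Q where Q: "M = P + Q" by (auto simp: subset_mset.le_iff_add)
    have "ce_sign d P Q = (-1) powi (p * ce_deg d Q) * (ce_sign d Q P :: 'k)" if "f P \<noteq> 0"
    proof -
      have "even (ce_deg d P - p)" using assms that by (simp add: has_parity_def)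
      then have "(-1) powi (ce_deg d P * ce_deg d Q) = ((-1) powi (p * ce_deg d Q) :: 'k)"
        by (intro minus_one_powi_cong) (simp flip: left_diff_distrib)
      then show ?thesis unfolding ce_sign_commute[OF M[unfolded Q]] by simp
    qed
    then show "ce_sign d (M - P) (M - (M - P)) * parity_twist d p g (M - P) * f (M - (M - P))
        = ce_sign d P (M - P) * f P * g (M - P)"
      unfolding Q by (auto simp: parity_twist_def algebra_simps)
  qed (auto simp: subset_mset.le_iff_add)
  then show "ce_mult n d f g M = ce_mult n d (parity_twist d p g) f M"
    by (simp add: ce_mult_def)
qed

lemma parity_twist_homogeneous:
  assumes "has_parity d q f"
  shows "parity_twist d p f = (\<lambda>M. (-1) powi (p * q) * f M)"
proof
  fix M
  have "even (p * ce_deg d M - p * q)" if "f M \<noteq> 0"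
    using assms that unfolding has_parity_def by (metis dvd_mult right_diff_distrib)
  then show "parity_twist d p f M = (-1) powi (p * q) * f M"
    by (cases "f M = 0") (auto simp: parity_twist_def minus_one_powi_cong)
qed

section \<open>Products of generators\<close>

lemma theta_word_simps [simp]:
  "theta_word n d [] = ce_one" "theta_word n d (a # w) = ce_mult n d (theta a) (theta_word n d w)"
  by (simp_all add: theta_word_def)

lemma theta_word_ce_monomial: "theta_word n d w M \<noteq> 0 \<Longrightarrow> ce_monomial n d M"
  by (cases w) (auto simp: ce_one_def ce_mult_def ce_monomial_def split: if_splits)

lemma theta_word_support: "(theta_word n d w M :: 'k::field) \<noteq> 0 \<Longrightarrow> M = mset w"
proof (induction w arbitrary: M)
  case (Cons a w)
  then have "{#a#} \<subseteq># M" "(theta_word n d w (M - {#a#}) :: 'k) \<noteq> 0"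
    by (auto simp: theta_monomial ce_mult_monomial_left split: if_splits)
  with Cons.IH[of "M - {#a#}"] show ?case by (metis insert_DiffM mset.simps(2) single_subset_iff)
qed (simp add: ce_one_def split: if_splits)

lemma has_parity_theta_word: "has_parity d (word_deg (theta_deg d) w) (theta_word n d w)"
  by (auto simp: has_parity_def ce_deg_mset dest: theta_word_support)

lemma theta_word_append:
  "theta_word n d (u @ v) = ce_mult n d (theta_word n d u) (theta_word n d v)"
  by (induction u) (simp_all add: ce_mult_one_left theta_word_ce_monomial ce_mult_assoc)

lemma has_parity_theta: "has_parity d (theta_deg d a) (theta a)"
  by (simp add: has_parity_def theta_def)

lemma theta_commute:
  "ce_mult n d (theta a) (theta b)
    = (\<lambda>M. theta_commutation d a b * ce_mult n d (theta b) (theta a) M)"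
  unfolding ce_mult_commute[OF has_parity_theta, of n d a "theta b"]
    parity_twist_homogeneous[OF has_parity_theta] ce_mult_scale_left theta_commutation_def ..

text \<open>By associativity it suffices to exchange the two leading generators of the tail.\<close>

lemma graded_symmetric_theta_word:
  "graded_symmetric (theta_commutation d) (\<lambda>w. theta_word n d w M)"
proof -
  have swap: "theta_word n d (a # b # v) = (\<lambda>M. theta_commutation d a b * theta_word n d (b # a # v) M)" for a b v
    by (simp add: ce_mult_assoc theta_commute[of n d a b] ce_mult_scale_left)
  show ?thesis
    unfolding graded_symmetric_def theta_word_append
  proof (intro allI)
    fix u a b v
    show "ce_mult n d (theta_word n d u) (theta_word n d (a # b # v)) M
        = theta_commutation d a b * ce_mult n d (theta_word n d u) (theta_word n d (b # a # v)) M"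
      unfolding swap[of a b v] ce_mult_scale_right ..
  qed
qed

text \<open>Multiplying by a generator of least index creates no inversion, hence no sign.\<close>

lemma theta_word_sorted:
  assumes "sorted w" "ce_monomial n d (mset w)"
  shows "theta_word n d w = (monomial (mset w) :: nat multiset \<Rightarrow> 'k::field)"
  using assms
proof (induction w)
  case (Cons b w)
  have "ce_monomial n d (mset w)" by (rule ce_monomial_mono[OF Cons.prems(2)]) simp
  then have IH: "theta_word n d w = (monomial (mset w) :: nat multiset \<Rightarrow> 'k)" using Cons by simp
  have none: "{#\<beta> \<in># mset w. \<beta> < b#} = {#}"
    using Cons.prems(1) by (intro multiset_eqI) (auto simp: count_eq_zero_iff not_less)
  have "ce_sign d {#b#} (mset w) = (1 :: 'k)" by (simp add: ce_sign_def none)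
  moreover have "M - {#b#} = mset w \<longleftrightarrow> M = mset (b # w)" if "b \<in># M" for M
    using that by (metis add_mset_remove_trivial insert_DiffM mset.simps(2))
  ultimately have "theta_word n d (b # w) M = (monomial (mset (b # w)) M :: 'k)" for M
    using Cons.prems(2) ce_mult_monomial_left[of n d "{#b#}" "monomial (mset w) :: _ \<Rightarrow> 'k" M]
    by (cases "b \<in># M") (auto simp: IH theta_monomial monomial_def[of "mset w"]
        monomial_def[of "add_mset b (mset w)"])
  then show ?case by (rule ext)
qed (simp add: ce_one_monomial)

section \<open>Operators determined by their values on monomials\<close>

text \<open>The last condition says that the coefficient of \<open>T f\<close> at \<open>M\<close> only depends on the coefficients of \<open>f\<close>
  of weight at most that of \<open>M\<close>. It is what makes \<open>T\<close> continuous for the weight filtration.\<close>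

definition filtered_linear ::
  "((nat multiset \<Rightarrow> 'k::field) \<Rightarrow> (nat multiset \<Rightarrow> 'k)) \<Rightarrow> bool" where
  "filtered_linear T \<longleftrightarrow>
     (\<forall>f g. T (\<lambda>M. f M + g M) = (\<lambda>M. T f M + T g M)) \<and>
     (\<forall>s f. T (\<lambda>M. s * f M) = (\<lambda>M. s * T f M)) \<and>
     (\<forall>f g M. (\<forall>N. size N \<le> size M \<longrightarrow> f N = g N) \<longrightarrow> T f M = T g M)"

lemma filtered_linearD:
  assumes "filtered_linear T"
  shows "T (\<lambda>M. f M + g M) = (\<lambda>M. T f M + T g M)"
    and "T (\<lambda>M. s * f M) = (\<lambda>M. s * T f M)"
    and "(\<And>N. size N \<le> size M \<Longrightarrow> f N = g N) \<Longrightarrow> T f M = T g M"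
  using assms unfolding filtered_linear_def by blast+

lemma filtered_linear_sum:
  assumes "filtered_linear T"
  shows "T (\<lambda>M. \<Sum>i\<in>A. s i * f i M) M = (\<Sum>i\<in>A. s i * T (f i) M)"
proof -
  have "T (\<lambda>M. 0) = (\<lambda>M. 0)" using filtered_linearD(2)[OF assms, of 0 "\<lambda>M. 0"] by simp
  then have "T (\<lambda>M. \<Sum>i\<in>A. s i * f i M) = (\<lambda>M. \<Sum>i\<in>A. s i * T (f i) M)"
    by (induction A rule: infinite_finite_induct)
      (simp_all add: filtered_linearD(1)[OF assms] filtered_linearD(2)[OF assms])
  then show ?thesis by simp
qed

lemma filtered_linear_comp:
  "filtered_linear S \<Longrightarrow> filtered_linear T \<Longrightarrow> filtered_linear (\<lambda>f. S (T f))"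
  unfolding filtered_linear_def by (intro conjI allI impI) (simp, simp, meson order_trans)

lemma filtered_linear_add:
  assumes "filtered_linear S" "filtered_linear T"
  shows "filtered_linear (\<lambda>f M. S f M + T f M)"
  unfolding filtered_linear_def
proof (intro conjI allI impI)
  fix f g :: "nat multiset \<Rightarrow> 'a" and M :: "nat multiset"
  assume "\<forall>N. size N \<le> size M \<longrightarrow> f N = g N"
  then show "S f M + T f M = S g M + T g M"
    using filtered_linearD(3)[OF assms(1), of M f g] filtered_linearD(3)[OF assms(2), of M f g] by simp
qed (simp_all add: filtered_linearD(1,2)[OF assms(1)] filtered_linearD(1,2)[OF assms(2)] algebra_simps)

lemma filtered_linear_scale:
  "filtered_linear T \<Longrightarrow> filtered_linear (\<lambda>f M. s M * T f M)"
  unfolding filtered_linear_def by (auto simp: algebra_simps fun_eq_iff)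

lemma filtered_linear_id: "filtered_linear (\<lambda>f. f)"
  by (simp add: filtered_linear_def)

lemma filtered_linear_parity_twist: "filtered_linear (parity_twist d p)"
  unfolding parity_twist_def[abs_def] by (rule filtered_linear_scale[OF filtered_linear_id])

lemma filtered_linear_mult_left: "filtered_linear (ce_mult n d g)"
  unfolding filtered_linear_def ce_mult_add_right ce_mult_scale_right
  by (auto simp: ce_mult_def size_Diff_submset intro!: sum.cong)

lemma filtered_linear_mult_right: "filtered_linear (\<lambda>f. ce_mult n d f g)"
  unfolding filtered_linear_def ce_mult_add_left ce_mult_scale_left
  by (auto simp: ce_mult_def size_mset_mono intro!: sum.cong)

lemma finite_ce_monomials: "finite {N. ce_monomial n d N \<and> size N \<le> k}"
proof (rule finite_subset)
  show "{N. ce_monomial n d N \<and> size N \<le> k} \<subseteq> mset ` {w. set w \<subseteq> {1..n} \<and> length w \<le> k}"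
  proof
    fix N assume "N \<in> {N. ce_monomial n d N \<and> size N \<le> k}"
    moreover obtain w where "N = mset w" by (metis ex_mset)
    ultimately show "N \<in> mset ` {w. set w \<subseteq> {1..n} \<and> length w \<le> k}"
      by (auto simp: ce_monomial_def)
  qed
  show "finite (mset ` {w. set w \<subseteq> {1..n} \<and> length w \<le> k})"
    by (intro finite_imageI finite_lists_length_le) simp
qed

text \<open>Up to weight \<open>size M\<close> a series supported on monomials agrees with a finite linear combination of
  monomials, because there are finitely many generators.\<close>

lemma filtered_linear_expand:
  assumes "filtered_linear T" and "\<And>M. f M \<noteq> 0 \<Longrightarrow> ce_monomial n d M"
  shows "T f M = (\<Sum>N | ce_monomial n d N \<and> size N \<le> size M. f N * T (monomial N) M)"
proof -
  have "T f M = T (\<lambda>M'. \<Sum>N | ce_monomial n d N \<and> size N \<le> size M. f N * monomial N M') M"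
  proof (rule filtered_linearD(3)[OF assms(1)])
    fix K :: "nat multiset" assume K: "size K \<le> size M"
    have "(\<Sum>N | ce_monomial n d N \<and> size N \<le> size M. f N * monomial N K)
        = (\<Sum>N | ce_monomial n d N \<and> size N \<le> size M. if N = K then f N else 0)"
      by (rule sum.cong) (auto simp: monomial_def)
    also have "\<dots> = f K" using assms(2)[of K] K by (auto simp: finite_ce_monomials)
    finally show "f K = (\<Sum>N | ce_monomial n d N \<and> size N \<le> size M. f N * monomial N K)" ..
  qed
  then show ?thesis by (simp add: filtered_linear_sum[OF assms(1)])
qed

lemma filtered_linear_eqI:
  assumes "filtered_linear S" "filtered_linear T" and "\<And>M. f M \<noteq> 0 \<Longrightarrow> ce_monomial n d M"
    and "\<And>N. ce_monomial n d N \<Longrightarrow> S (monomial N) = T (monomial N)"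
  shows "S f = T f"
  using assms(4) by (auto simp: fun_eq_iff filtered_linear_expand[OF assms(1,3)]
      filtered_linear_expand[OF assms(2,3)] intro!: sum.cong)

section \<open>The derivation\<close>

text \<open>The exponent of the sign in the definition of \<open>\<delta>\<theta>\<^sup>\<alpha>\<close>, written recursively: prepending \<open>x\<close> shifts the
  positions of the letters of \<open>w\<close> by one, which adds the total degree of \<open>w\<close>.\<close>

primrec position_exponent :: "(nat \<Rightarrow> int) \<Rightarrow> nat list \<Rightarrow> int" where
  "position_exponent d [] = 0"
| "position_exponent d (x # w) = d x * (1 + word_deg d w) + word_deg d w + position_exponent d w"

definition position_sign :: "(nat \<Rightarrow> int) \<Rightarrow> nat list \<Rightarrow> 'k::field" where
  "position_sign d w = (-1) powi position_exponent d w"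

lemma position_exponent_sum:
  "(\<Sum>l=1..length w. d (w ! (l - 1)) * (int l + (\<Sum>m=l+1..length w. d (w ! (m - 1)))))
    = position_exponent d w"
proof -
  have inner: "(\<Sum>m=l+1..length w. d (w ! (m - 1))) = word_deg d (drop l w)" for l w
  proof -
    have "(\<Sum>m=l+1..length w. d (w ! (m - 1))) = (\<Sum>i<length w - l. d (w ! (l + i)))"
      by (rule sum.reindex_bij_witness[of _ "\<lambda>i. l + i + 1" "\<lambda>m. m - l - 1"]) auto
    then show ?thesis by (simp add: sum_list_sum_nth atLeast0LessThan)
  qed
  have "(\<Sum>l=1..length w. d (w ! (l - 1)) * (int l + word_deg d (drop l w)))
      = (\<Sum>l<length w. d (w ! l) * (int l + 1 + word_deg d (drop (l + 1) w)))"
    by (rule sum.reindex_bij_witness[of _ "\<lambda>i. i + 1" "\<lambda>m. m - 1"]) auto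
  also have "\<dots> = position_exponent d w"
  proof (induction w)
    case (Cons x w)
    have "(\<Sum>l<length w. d (w ! l) * (2 + int l + word_deg d (drop (l + 1) w)))
        = (\<Sum>l<length w. d (w ! l) * (int l + 1 + word_deg d (drop (l + 1) w))) + word_deg d w"
      by (simp add: sum_list_sum_nth atLeast0LessThan algebra_simps flip: sum.distrib)
    with Cons.IH show ?case by (simp add: sum.lessThan_Suc_shift del: sum.lessThan_Suc)
  qed simp
  finally show ?thesis unfolding inner .
qed

lemma position_exponent_append:
  "position_exponent d (u @ v) = position_exponent d u + position_exponent d v
    + word_deg d u * word_deg d v + int (length u) * word_deg d v"
  by (induction u) (simp_all add: algebra_simps)

text \<open>Only the position-dependent part is affected by the exchange: one degree gains and the other
  loses one position.\<close>

lemma position_sign_swap: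
  "position_sign d (u @ a # b # v) = ((-1) powi (d a + d b) * position_sign d (u @ b # a # v) :: 'k::field)"
  unfolding position_sign_def minus_one_powi_mult
  by (rule minus_one_powi_cong) (simp add: position_exponent_append algebra_simps)

text \<open>What the argument uses about structure constants: the vanishing for indices outside the basis
  saves side conditions throughout; skew symmetry and degree are those of \<open>\<Lambda>\<^sup>i \<gg> \<rightarrow> \<gg>[2 - i]\<close>.\<close>

locale ce_derivation =
  fixes n :: nat and d :: "nat \<Rightarrow> int" and c :: "nat \<Rightarrow> nat list \<Rightarrow> 'k::field_char_0"
  assumes c_range: "c \<alpha> w \<noteq> 0 \<Longrightarrow> \<alpha> \<in> {1..n} \<and> set w \<subseteq> {1..n}"
    and c_skew: "graded_symmetric (skew_commutation d) (c \<alpha>)"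
    and c_degree: "w \<noteq> [] \<Longrightarrow> c \<alpha> w \<noteq> 0 \<Longrightarrow> d \<alpha> = word_deg d w + 2 - int (length w)"
begin

abbreviation mult (infixl "\<star>" 70) where "f \<star> g \<equiv> ce_mult n d f g"
abbreviation tw :: "nat list \<Rightarrow> nat multiset \<Rightarrow> 'k" where "tw \<equiv> theta_word n d"
abbreviation \<delta>g where "\<delta>g \<equiv> delta_gen n d c"
abbreviation \<delta>w where "\<delta>w \<equiv> delta_word n d c"
abbreviation \<delta> where "\<delta> \<equiv> delta n d c"
abbreviation e where "e \<equiv> theta_deg d"
abbreviation \<kappa> where "\<kappa> \<equiv> theta_commutation d"

text \<open>The coefficient of \<open>\<theta>\<^sup>w\<close> in \<open>\<delta>\<theta>\<^sup>\<alpha>\<close>, without the factor \<open>1 / i!\<close>.\<close>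

definition sym_const :: "nat \<Rightarrow> nat list \<Rightarrow> 'k" where
  "sym_const \<alpha> w = position_sign d w * c \<alpha> w"

lemma delta_gen_expand:
  "\<delta>g \<alpha> M = (\<Sum>i=1..size M. \<Sum>w\<in>words {1..n} i. 1 / fact i * sym_const \<alpha> w * tw w M)"
proof -
  have "words {1..n} i = {w. length w = i \<and> set w \<subseteq> {1..n}}" for i
    by (simp add: words_def)
  then show ?thesis
    unfolding delta_gen_def
    by (intro sum.cong refl) (auto simp: sym_const_def position_sign_def words_def mult.assoc
        simp flip: position_exponent_sum)
qed

text \<open>A filtered linear operator may be applied to the series \<open>\<delta>\<theta>\<^sup>\<alpha>\<close> term by term; in weight at most \<open>k\<close>
  only words of length at most \<open>k\<close> matter.\<close>

lemma filtered_linear_delta_gen: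
  assumes "filtered_linear T" "size M \<le> k"
  shows "T (\<delta>g \<alpha>) M = (\<Sum>i=1..k. \<Sum>w\<in>words {1..n} i. 1 / fact i * sym_const \<alpha> w * T (tw w) M)"
proof -
  have tw0: "tw w N = (0 :: 'k)" if "w \<in> words {1..n} i" "i \<noteq> size N" for w i N
  proof (rule ccontr)
    assume "tw w N \<noteq> 0"
    from theta_word_support[OF this] that show False by (auto simp: words_def)
  qed
  have "T (\<delta>g \<alpha>) M
    = T (\<lambda>N. \<Sum>(i, w)\<in>(SIGMA i:{1..k}. words {1..n} i). 1 / fact i * sym_const \<alpha> w * tw w N) M"
  proof (rule filtered_linearD(3)[OF assms(1)])
    fix N :: "nat multiset" assume N: "size N \<le> size M"
    have "\<delta>g \<alpha> N = (\<Sum>i=1..k. \<Sum>w\<in>words {1..n} i. 1 / fact i * sym_const \<alpha> w * tw w N)"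
      unfolding delta_gen_expand using N assms(2) tw0
      by (intro sum.mono_neutral_left) auto
    then show "\<delta>g \<alpha> N
        = (\<Sum>(i, w)\<in>(SIGMA i:{1..k}. words {1..n} i). 1 / fact i * sym_const \<alpha> w * tw w N)"
      by (simp add: sum.Sigma)
  qed
  also have "(\<lambda>N. \<Sum>(i, w)\<in>(SIGMA i:{1..k}. words {1..n} i). 1 / fact i * sym_const \<alpha> w * tw w N)
    = (\<lambda>N. \<Sum>z\<in>(SIGMA i:{1..k}. words {1..n} i). (1 / fact (fst z) * sym_const \<alpha> (snd z)) * tw (snd z) N)"
    by (simp add: case_prod_beta)
  also have "T \<dots> M = (\<Sum>z\<in>(SIGMA i:{1..k}. words {1..n} i). (1 / fact (fst z) * sym_const \<alpha> (snd z)) * T (tw (snd z)) M)"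
    by (rule filtered_linear_sum[OF assms(1)])
  finally show ?thesis by (simp add: sum.Sigma case_prod_beta)
qed

text \<open>With \<open>|\<theta>\<^sup>a| = 1 - d a\<close>, the Koszul sign \<open>(1 - d a) (1 - d b)\<close> of the generators differs from the skew
  sign \<open>1 + d a * d b\<close> of the brackets by \<open>d a + d b\<close>, and this is the change of the position sign.\<close>

lemma graded_symmetric_sym_const: "graded_symmetric \<kappa> (sym_const \<alpha>)"
  unfolding graded_symmetric_def
proof (intro allI)
  fix u a b v
  have "(-1) powi (d a + d b) * skew_commutation d a b = (\<kappa> a b :: 'k)"
    by (simp add: theta_commutation_def skew_commutation_def theta_deg_def minus_one_powi algebra_simps)
  moreover have "sym_const \<alpha> (u @ a # b # v)
      = ((-1) powi (d a + d b) * skew_commutation d a b) * sym_const \<alpha> (u @ b # a # v)"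
    unfolding sym_const_def position_sign_swap[of d u a b v]
      graded_symmetric_swap[OF c_skew, of \<alpha> u a b v] by (simp only: mult_ac)
  ultimately show "sym_const \<alpha> (u @ a # b # v) = \<kappa> a b * sym_const \<alpha> (u @ b # a # v)"
    by simp
qed

text \<open>\<open>\<delta>\<close> is odd because the \<open>i\<close>-ary bracket has degree \<open>2 - i\<close>.\<close>

lemma has_parity_delta_gen: "has_parity d (e \<alpha> + 1) (\<delta>g \<alpha>)"
  unfolding has_parity_def
proof (intro allI impI)
  fix M assume "\<delta>g \<alpha> M \<noteq> 0"
  then obtain i w where w: "i \<ge> 1" "w \<in> words {1..n} i" "sym_const \<alpha> w * tw w M \<noteq> 0"
    unfolding delta_gen_expand by (force elim!: sum.not_neutral_contains_not_neutral)
  then have "w \<noteq> []" "c \<alpha> w \<noteq> 0" "M = mset w"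
    using theta_word_support by (auto simp: sym_const_def words_def)
  moreover have "word_deg e w = int (length w) - word_deg d w" for w
    by (induction w) (auto simp: theta_deg_def)
  ultimately show "even (ce_deg d M - (e \<alpha> + 1))"
    using c_degree[of w \<alpha>] by (simp add: ce_deg_mset theta_deg_def)
qed

lemma delta_word_range: "\<delta>w w M = 0" if "\<not> set w \<subseteq> {1..n}"
proof -
  have gen: "\<delta>g \<beta> = (\<lambda>M. 0)" if "\<beta> \<notin> {1..n}" for \<beta>
  proof -
    have "c \<beta> w = 0" for w using that c_range[of \<beta> w] by blast
    then show ?thesis by (simp add: fun_eq_iff delta_gen_expand sym_const_def)
  qed
  have tw: "tw w = (\<lambda>M. 0)" if "\<not> set w \<subseteq> {1..n}" for w
  proof (rule ext, rule ccontr)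
    fix N assume "tw w N \<noteq> 0"
    from theta_word_support[OF this] theta_word_ce_monomial[OF this] that
    show False by (simp add: ce_monomial_def)
  qed
  have th: "(theta \<beta> :: nat multiset \<Rightarrow> 'k) \<star> f = (\<lambda>M. 0)" if "\<beta> \<notin> {1..n}" for \<beta> f
    using that by (auto simp: fun_eq_iff theta_monomial ce_mult_monomial_left ce_monomial_def)
  have "\<delta>w w = (\<lambda>M. 0)" using that
  proof (induction w)
    case (Cons a w)
    show ?case
    proof (cases "set w \<subseteq> {1..n}")
      case True
      with Cons.prems have "a \<notin> {1..n}" by auto
      then show ?thesis by (simp add: gen th)
    qed (simp add: tw Cons.IH)
  qed simp
  then show ?thesis by simp
qed

text \<open>The Leibniz law for words, where it follows from the recursive definition and associativity alone.\<close>

lemma delta_word_append: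
  "\<delta>w (u @ v) M = (\<delta>w u \<star> tw v) M + (-1) powi (word_deg e u) * (tw u \<star> \<delta>w v) M"
proof (induction u arbitrary: M)
  case Nil
  have "\<delta>w v M = 0" if "\<not> ce_monomial n d M" for M
    using that by (cases v) (simp_all add: ce_mult_nonmonomial)
  then have "ce_one \<star> \<delta>w v = \<delta>w v" by (intro ce_mult_one_left) auto
  then show ?case by simp
next
  case (Cons b u)
  have "\<delta>w (u @ v) = (\<lambda>M. (\<delta>w u \<star> tw v) M + (-1) powi (word_deg e u) * (tw u \<star> \<delta>w v) M)"
    by (rule ext) (rule Cons.IH)
  then show ?case
    by (simp add: theta_word_append ce_mult_assoc ce_mult_add_left ce_mult_add_right
        ce_mult_scale_left ce_mult_scale_right power_int_add algebra_simps)
qed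

text \<open>\<open>\<delta>\<close> does not lower the weight, since \<open>\<delta>\<theta>\<^sup>\<alpha>\<close> has no constant term.\<close>

lemma delta_word_support: "\<delta>w w M \<noteq> 0 \<Longrightarrow> ce_monomial n d M \<and> length w \<le> size M"
proof (induction w arbitrary: M)
  case (Cons b w)
  have mon: "ce_monomial n d M"
    using Cons.prems by (auto simp: ce_mult_nonmonomial intro: ccontr)
  from Cons.prems consider "(\<delta>g b \<star> tw w) M \<noteq> 0" | "(theta b \<star> \<delta>w w) M \<noteq> 0" by force
  then show ?case
  proof cases
    case 1
    then obtain P where P: "P \<subseteq># M" "\<delta>g b P \<noteq> 0" "(tw w (M - P) :: 'k) \<noteq> 0"
      by (auto simp: ce_mult_def elim!: sum.not_neutral_contains_not_neutral split: if_splits)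
    from P(2) have "P \<noteq> {#}" by (auto simp: delta_gen_expand)
    then have "size P \<ge> 1" by (cases P) auto
    moreover have "size (M - P) = length w" using theta_word_support[OF P(3)] by simp
    ultimately show ?thesis using mon P(1) size_mset_mono[OF P(1)] by (simp add: size_Diff_submset)
  next
    case 2
    then have "b \<in># M" "\<delta>w w (M - {#b#}) \<noteq> 0"
      by (auto simp: theta_monomial ce_mult_monomial_left split: if_splits)
    then obtain M' where M': "M = add_mset b M'" by (auto dest: multi_member_split)
    then have "length w \<le> size M'" using Cons.IH[of M'] \<open>\<delta>w w (M - {#b#}) \<noteq> 0\<close> by simp
    with mon M' show ?thesis by simp
  qed
qed simp

text \<open>This is the well-definedness of \<open>\<delta>\<close> on products of generators: rearranging the product changes its
  derivative by the same sign as the product itself. In the two Leibniz terms for the first two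
  letters the roles of \<open>a\<close> and \<open>b\<close> are interchanged, as \<open>\<delta>\<theta>\<^sup>a\<close> has parity \<open>|\<theta>\<^sup>a| + 1\<close>.\<close>

lemma graded_symmetric_delta_word: "graded_symmetric \<kappa> (\<lambda>w. \<delta>w w M)"
  unfolding graded_symmetric_def
proof (intro allI)
  fix u a b v
  have dg: "\<delta>g a \<star> theta b = (\<lambda>M. (-1) powi ((e a + 1) * e b) * (theta b \<star> \<delta>g a) M)" for a b
    by (simp add: ce_mult_commute[OF has_parity_delta_gen] parity_twist_homogeneous[OF has_parity_theta] ce_mult_scale_left)
  have expand: "\<delta>w (a # b # v) = (\<lambda>M. (-1) powi ((e a + 1) * e b) * (theta b \<star> \<delta>g a \<star> tw v) M
      + (-1) powi (e a) * (theta a \<star> \<delta>g b \<star> tw v) M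
      + (-1) powi (e a) * (-1) powi (e b) * (theta a \<star> theta b \<star> \<delta>w v) M)" for a b v
    by (simp add: ce_mult_assoc dg ce_mult_add_right ce_mult_scale_left ce_mult_scale_right)
      (simp add: algebra_simps)
  have 1: "(-1) powi ((e a + 1) * e b) = \<kappa> a b * ((-1) powi e b :: 'k)"
    "(-1) powi e a = \<kappa> a b * ((-1) powi ((e b + 1) * e a) :: 'k)"
    by (simp_all add: theta_commutation_def minus_one_powi)
  have combine: "s * x + t * y + t * t' * (q * z) = q * (s' * y + t' * x + t' * t * z)"
    if "s = q * t'" "t = q * s'" for q s s' t t' x y z :: 'k
    using that by (simp add: algebra_simps)
  have "\<delta>w (a # b # v) = (\<lambda>M. \<kappa> a b * \<delta>w (b # a # v) M)"
    unfolding expand[of a b v] expand[of b a v] theta_commute[of n d a b] ce_mult_scale_left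
    by (rule ext) (rule combine[OF 1])
  moreover have "tw (a # b # v) = (\<lambda>M. \<kappa> a b * tw (b # a # v) M)"
    by (rule ext) (rule graded_symmetric_swap[OF graded_symmetric_theta_word, where u = "[]", unfolded append_Nil])
  ultimately have "\<delta>w (a # b # v) = (\<lambda>M. \<kappa> a b * \<delta>w (b # a # v) M)" "tw (a # b # v) = (\<lambda>M. \<kappa> a b * tw (b # a # v) M)" .
  then show "\<delta>w (u @ a # b # v) M = \<kappa> a b * \<delta>w (u @ b # a # v) M"
    unfolding delta_word_append by (simp only: ce_mult_scale_right distrib_left mult_ac)
qed

end

section \<open>The square of the derivation\<close>

text \<open>In contrast to \<open>CE n d\<close>, infinitely many degrees are allowed; the algebraic identities hold in
  this larger algebra, and membership is preserved by all operations without bookkeeping of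
  degrees.\<close>

definition formal_series :: "nat \<Rightarrow> (nat \<Rightarrow> int) \<Rightarrow> (nat multiset \<Rightarrow> 'k::field) set" where
  "formal_series n d = {f. \<forall>M. f M \<noteq> 0 \<longrightarrow> ce_monomial n d M}"

lemma formal_series_intros [intro, simp]:
  "ce_mult n d f g \<in> formal_series n d"
  "theta_word n d w \<in> formal_series n d"
  "ce_monomial n d N \<Longrightarrow> monomial N \<in> formal_series n d"
  "f \<in> formal_series n d \<Longrightarrow> parity_twist d p f \<in> formal_series n d"
  using theta_word_ce_monomial ce_mult_nonmonomial[of n d _ f g]
  by (fastforce simp: formal_series_def monomial_def parity_twist_def)+

text \<open>After moving two copies of \<open>a\<close> to the front, exchanging them gives \<open>F = - F\<close>.\<close>

lemma graded_symmetric_repeated: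
  fixes F :: "nat list \<Rightarrow> 'k::field_char_0"
  assumes F: "graded_symmetric (theta_commutation d) F"
    and "odd (theta_deg d a)" "count (mset w) a \<ge> 2"
  shows "F w = 0"
proof -
  have "replicate_mset 2 a \<subseteq># mset w" using assms(3) by (simp add: count_le_replicate_mset_subset_eq)
  then obtain M where "mset w = replicate_mset 2 a + M" by (metis subset_mset.add_diff_inverse)
  moreover obtain v where "M = mset v" by (metis ex_mset)
  ultimately have "mset w = mset (a # a # v)" by (simp add: numeral_2_eq_2)
  from graded_symmetric_same_letters[OF commutation_factor_theta[of d] this]
  obtain s where s: "\<And>F. graded_symmetric (theta_commutation d) F \<Longrightarrow> F w = s * (F (a # a # v) :: 'k)" by metis
  have "theta_commutation d a a = (- 1 :: 'k)"
    using assms(2) by (simp add: theta_commutation_def minus_one_powi)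
  then have "F (a # a # v) = - F (a # a # v)"
    using graded_symmetric_swap[OF F, of "[]" a a v] by simp
  then have "F (a # a # v) = 0" by simp
  with s[OF F] show ?thesis by simp
qed

lemma not_ce_monomial_msetE:
  assumes "\<not> ce_monomial n d (mset w)"
  obtains "\<not> set w \<subseteq> {1..n}" | a where "odd (theta_deg d a)" "count (mset w) a \<ge> 2"
  using assms unfolding ce_monomial_def by (auto simp: not_le numeral_2_eq_2 less_eq_Suc_le)

lemma has_parity_mult:
  assumes "has_parity d p f" "has_parity d q g"
  shows "has_parity d (p + q) (ce_mult n d f g)"
  unfolding has_parity_def
proof (intro allI impI)
  fix M assume "ce_mult n d f g M \<noteq> 0"
  then obtain P where "P \<subseteq># M" "f P \<noteq> 0" "g (M - P) \<noteq> 0"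
    by (auto simp: ce_mult_def elim!: sum.not_neutral_contains_not_neutral split: if_splits)
  then have "even (ce_deg d P - p)" "even (ce_deg d (M - P) - q)" "ce_deg d M = ce_deg d P + ce_deg d (M - P)"
    using assms ce_deg_simps(3)[of d P "M - P"] by (auto simp: has_parity_def)
  then show "even (ce_deg d M - (p + q))" by presburger
qed

context ce_derivation
begin

lemma has_parity_delta_word: "has_parity d (word_deg e w + 1) (\<delta>w w)"
proof (induction w)
  case (Cons b w)
  have "has_parity d (word_deg e (b # w) + 1) (\<delta>g b \<star> tw w)"
    using has_parity_mult[OF has_parity_delta_gen[of b] has_parity_theta_word[of d w n], of n] by (simp add: algebra_simps)
  moreover have "has_parity d (word_deg e (b # w) + 1) (theta b \<star> \<delta>w w)"
    using has_parity_mult[OF has_parity_theta[of d b] Cons, of n] by (simp add: algebra_simps)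
  ultimately show ?case unfolding has_parity_def by (simp, metis add_0 mult_zero_right)
qed (simp add: has_parity_def)

lemma filtered_linear_delta: "filtered_linear \<delta>"
  unfolding filtered_linear_def delta_def
  by (auto simp: fun_eq_iff algebra_simps sum.distrib sum_distrib_left intro!: sum.cong)

lemma delta_monomial:
  assumes "ce_monomial n d N"
  shows "\<delta> (monomial N) = \<delta>w (sorted_list_of_multiset N)"
proof
  fix M
  have "\<delta> (monomial N) M = (\<Sum>N' | ce_monomial n d N' \<and> size N' \<le> size M.
      if N' = N then \<delta>w (sorted_list_of_multiset N) M else 0)"
    unfolding delta_def by (rule sum.cong) (auto simp: monomial_def)
  also have "\<dots> = (if size N \<le> size M then \<delta>w (sorted_list_of_multiset N) M else 0)"
    using assms by (simp add: finite_ce_monomials)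
  also have "\<dots> = \<delta>w (sorted_list_of_multiset N) M"
    using delta_word_support[of "sorted_list_of_multiset N" M]
    by (auto simp flip: size_mset)
  finally show "\<delta> (monomial N) M = \<delta>w (sorted_list_of_multiset N) M" .
qed

lemma theta_word_sorted_list:
  "ce_monomial n d N \<Longrightarrow> tw (sorted_list_of_multiset N) = monomial N"
  using theta_word_sorted[of "sorted_list_of_multiset N" n d] by simp

text \<open>On sorted words this is the definition of \<open>\<delta>\<close>. For other words both sides change by the same sign
  under sorting, and if the word does not represent a monomial both sides vanish.\<close>

lemma delta_theta_word: "\<delta> (tw w) = \<delta>w w"
proof (cases "ce_monomial n d (mset w)")
  case True
  let ?N = "mset w"
  have "mset w = mset (sorted_list_of_multiset ?N)" by simp
  from graded_symmetric_same_letters[OF commutation_factor_theta[of d] this]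
  obtain s :: 'k where s: "\<And>F. graded_symmetric \<kappa> F \<Longrightarrow> F w = s * F (sorted_list_of_multiset ?N)"
    by metis
  have "tw w = (\<lambda>M. s * monomial ?N M)"
    using s[OF graded_symmetric_theta_word] theta_word_sorted_list[OF True] by (simp add: fun_eq_iff)
  then have "\<delta> (tw w) = (\<lambda>M. s * \<delta>w (sorted_list_of_multiset ?N) M)"
    using delta_monomial[OF True] by (simp add: filtered_linearD(2)[OF filtered_linear_delta])
  also have "\<dots> = \<delta>w w" using s[OF graded_symmetric_delta_word] by (simp add: fun_eq_iff)
  finally show ?thesis .
next
  case False
  have "tw w = (\<lambda>M. 0)"
  proof (rule ext, rule ccontr)
    fix M assume "tw w M \<noteq> 0"
    from theta_word_support[OF this] theta_word_ce_monomial[OF this] False show False by simp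
  qed
  then have "\<delta> (tw w) = (\<lambda>M. 0)" by (simp add: delta_def)
  moreover from False have "\<delta>w w = (\<lambda>M. 0)"
  proof (cases rule: not_ce_monomial_msetE)
    case 1
    then show ?thesis using delta_word_range by blast
  next
    case (2 a)
    then show ?thesis using graded_symmetric_repeated[OF graded_symmetric_delta_word] by blast
  qed
  ultimately show ?thesis by simp
qed

lemma delta_formal_series [simp]: "\<delta> f \<in> formal_series n d"
proof -
  have "\<delta> f M = 0" if "\<not> ce_monomial n d M" for M
    unfolding delta_def using delta_word_support that by (intro sum.neutral) fastforce
  then show ?thesis unfolding formal_series_def by auto
qed

text \<open>Equality of filtered linear operators need only be checked on words in the generators.\<close>

lemma filtered_linear_eq:
  assumes "f \<in> formal_series n d" "filtered_linear S" "filtered_linear T"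
    and "\<And>u. set u \<subseteq> {1..n} \<Longrightarrow> S (tw u) = T (tw u)"
  shows "S f = T f"
proof (rule filtered_linear_eqI[of S T f n d])
  show "ce_monomial n d M" if "f M \<noteq> 0" for M using assms(1) that by (auto simp: formal_series_def)
  show "S (monomial N) = T (monomial N)" if N: "ce_monomial n d N" for N
    using assms(4)[of "sorted_list_of_multiset N"] N
    by (simp add: theta_word_sorted_list) (simp add: ce_monomial_def)
qed fact+

lemma parity_twist_theta_word: "parity_twist d 1 (tw u) = (\<lambda>M. (-1) powi word_deg e u * tw u M)"
  by (simp add: parity_twist_homogeneous[OF has_parity_theta_word])

text \<open>With one factor fixed, both sides are filtered linear in the other. This reduces the law to
  products of two words, where it is \<open>delta_word_append\<close>.\<close>

lemma delta_leibniz: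
  assumes "f \<in> formal_series n d" "g \<in> formal_series n d"
  shows "\<delta> (f \<star> g) = (\<lambda>M. (\<delta> f \<star> g) M + (parity_twist d 1 f \<star> \<delta> g) M)"
  using assms(1)
proof (rule filtered_linear_eq)
  show "filtered_linear (\<lambda>f. \<delta> (f \<star> g))"
    by (rule filtered_linear_comp[OF filtered_linear_delta filtered_linear_mult_right])
  show "filtered_linear (\<lambda>f M. (\<delta> f \<star> g) M + (parity_twist d 1 f \<star> \<delta> g) M)"
    by (rule filtered_linear_add[OF
          filtered_linear_comp[OF filtered_linear_mult_right filtered_linear_delta]
          filtered_linear_comp[OF filtered_linear_mult_right filtered_linear_parity_twist]])
  show "\<delta> (tw u \<star> g) = (\<lambda>M. (\<delta> (tw u) \<star> g) M + (parity_twist d 1 (tw u) \<star> \<delta> g) M)" for u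
    using assms(2)
  proof (rule filtered_linear_eq)
    show "filtered_linear (\<lambda>g. \<delta> (tw u \<star> g))"
      by (rule filtered_linear_comp[OF filtered_linear_delta filtered_linear_mult_left])
    show "filtered_linear (\<lambda>g M. (\<delta> (tw u) \<star> g) M + (parity_twist d 1 (tw u) \<star> \<delta> g) M)"
      by (rule filtered_linear_add[OF filtered_linear_mult_left
            filtered_linear_comp[OF filtered_linear_mult_left filtered_linear_delta]])
    show "\<delta> (tw u \<star> tw v) = (\<lambda>M. (\<delta> (tw u) \<star> tw v) M + (parity_twist d 1 (tw u) \<star> \<delta> (tw v)) M)" for v
      by (simp add: delta_theta_word delta_word_append fun_eq_iff parity_twist_theta_word
          ce_mult_scale_left flip: theta_word_append)
  qed
qed

lemma delta_parity_twist:
  assumes "f \<in> formal_series n d"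
  shows "\<delta> (parity_twist d 1 f) = (\<lambda>M. - 1 * parity_twist d 1 (\<delta> f) M)"
  using assms
proof (rule filtered_linear_eq)
  fix u
  have "parity_twist d 1 (\<delta>w u) = (\<lambda>M. (-1) powi (word_deg e u + 1) * \<delta>w u M)"
    by (simp add: parity_twist_homogeneous[OF has_parity_delta_word])
  then show "\<delta> (parity_twist d 1 (tw u)) = (\<lambda>M. - 1 * parity_twist d 1 (\<delta> (tw u)) M)"
    by (simp add: parity_twist_theta_word filtered_linearD(2)[OF filtered_linear_delta] delta_theta_word
        power_int_add)
next
  show "filtered_linear (\<lambda>f. \<delta> (parity_twist d 1 f))"
    by (rule filtered_linear_comp[OF filtered_linear_delta filtered_linear_parity_twist])
  show "filtered_linear (\<lambda>f M. - 1 * parity_twist d 1 (\<delta> f) M)"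
    by (rule filtered_linear_scale[OF filtered_linear_comp[OF filtered_linear_parity_twist filtered_linear_delta]])
qed

text \<open>The mixed terms cancel because \<open>\<delta>\<close> anticommutes with the parity automorphism.\<close>

lemma delta_square_derivation:
  assumes f: "f \<in> formal_series n d" and g: "g \<in> formal_series n d"
  shows "\<delta> (\<delta> (f \<star> g)) = (\<lambda>M. (\<delta> (\<delta> f) \<star> g) M + (f \<star> \<delta> (\<delta> g)) M)"
proof -
  have "parity_twist d 1 (parity_twist d 1 f) = f"
    by (simp add: parity_twist_def fun_eq_iff flip: mult.assoc add: minus_one_powi_square)
  then show ?thesis
    using f g
    by (simp add: delta_leibniz filtered_linearD(1)[OF filtered_linear_delta] delta_parity_twist
        ce_mult_scale_left[of n d "- 1", simplified])
qed

lemma delta_theta: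
  assumes "\<alpha> \<in> {1..n}"
  shows "\<delta> (theta \<alpha>) = \<delta>g \<alpha>" and "theta \<alpha> \<in> (formal_series n d :: (nat multiset \<Rightarrow> 'k) set)"
proof -
  have \<delta>g: "\<delta>g \<alpha> M \<noteq> 0 \<Longrightarrow> ce_monomial n d M" for M
    unfolding delta_gen_expand using theta_word_ce_monomial
    by (fastforce elim!: sum.not_neutral_contains_not_neutral)
  have \<theta>: "ce_monomial n d {#\<alpha>#}" using assms by (simp add: ce_monomial_def)
  then show 1: "theta \<alpha> \<in> (formal_series n d :: (nat multiset \<Rightarrow> 'k) set)" by (simp add: theta_monomial)
  then have "theta \<alpha> = tw [\<alpha>]"
    using ce_mult_one_right[of "theta \<alpha> :: _ \<Rightarrow> 'k" n d] by (simp add: formal_series_def)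
  then have "\<delta> (theta \<alpha>) = \<delta>w [\<alpha>]" by (simp only: delta_theta_word)
  also have "\<dots> = \<delta>g \<alpha>" using ce_mult_one_right[of "\<delta>g \<alpha>" n d] \<delta>g by simp
  finally show "\<delta> (theta \<alpha>) = \<delta>g \<alpha>" .
qed

lemma delta_square_zero_iff_generators:
  "(\<forall>f\<in>formal_series n d. \<delta> (\<delta> f) = (\<lambda>M. 0)) \<longleftrightarrow> (\<forall>\<alpha>\<in>{1..n}. \<delta> (\<delta>g \<alpha>) = (\<lambda>M. 0))"
proof
  assume "\<forall>f\<in>formal_series n d. \<delta> (\<delta> f) = (\<lambda>M. 0)"
  then show "\<forall>\<alpha>\<in>{1..n}. \<delta> (\<delta>g \<alpha>) = (\<lambda>M. 0)" using delta_theta by metis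
next
  assume gen: "\<forall>\<alpha>\<in>{1..n}. \<delta> (\<delta>g \<alpha>) = (\<lambda>M. 0)"
  have z: "\<delta> (\<lambda>M. 0) = (\<lambda>M. 0)" by (simp add: delta_def)
  have words: "\<delta> (\<delta> (tw w)) = (\<lambda>M. 0)" if "set w \<subseteq> {1..n}" for w
    using that
  proof (induction w)
    case Nil
    then show ?case using delta_theta_word[of "[]"] by (simp add: z)
  next
    case (Cons a w)
    then show ?case using delta_theta[of a] gen
      by (simp add: delta_square_derivation)
  qed
  show "\<forall>f\<in>formal_series n d. \<delta> (\<delta> f) = (\<lambda>M. 0)"
  proof
    fix f :: "nat multiset \<Rightarrow> 'k" assume "f \<in> formal_series n d"
    then show "\<delta> (\<delta> f) = (\<lambda>M. 0)"
    proof (rule filtered_linear_eq)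
      show "filtered_linear (\<lambda>f. \<delta> (\<delta> f))"
        by (rule filtered_linear_comp[OF filtered_linear_delta filtered_linear_delta])
      show "filtered_linear (\<lambda>f M. 0 :: 'k)" by (simp add: filtered_linear_def)
    qed (simp add: words)
  qed
qed

end

section \<open>The square of the derivation on generators\<close>

text \<open>Passing a generator across a whole word only depends on the total degree of the word.\<close>

lemma pass_factor_theta:
  "pass_factor (theta_commutation d) b w = ((-1) powi (theta_deg d b * word_deg (theta_deg d) w) :: 'k::field)"
  by (induction w) (simp_all add: theta_commutation_def minus_one_powi_mult distrib_left)

context ce_derivation
begin

text \<open>By the Leibniz law the derivative of a word is a sum over its letters. Moving the differentiated
  letter \<open>\<beta>\<close> to the end of the index word and \<open>\<delta>\<theta>\<^sup>\<beta>\<close> to the end of the product costs the signs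
  \<open>|\<theta>\<^sup>\<beta>| |\<theta>\<^sup>w|\<close> and \<open>(|\<theta>\<^sup>\<beta>| + 1) |\<theta>\<^sup>w|\<close>, of which \<open>|\<theta>\<^sup>w|\<close> remains; after summation over all words the \<open>i\<close>
  letters contribute equally.\<close>

lemma sum_symmetric_delta_word:
  assumes "graded_symmetric \<kappa> B"
  shows "(\<Sum>w\<in>words {1..n} i. B w * \<delta>w w M)
    = of_nat i * (\<Sum>w\<in>words {1..n} (i - 1). \<Sum>\<beta>=1..n.
        B (w @ [\<beta>]) * (-1) powi word_deg e w * (tw w \<star> \<delta>g \<beta>) M)"
  using assms
proof (induction i arbitrary: B M)
  case (Suc i)
  \<comment> \<open>The first letter is differentiated: it moves to the end.\<close>
  have first: "B (\<beta> # w) * (\<delta>g \<beta> \<star> tw w) M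
      = B (w @ [\<beta>]) * (-1) powi word_deg e w * (tw w \<star> \<delta>g \<beta>) M" for \<beta> w
  proof -
    have "\<delta>g \<beta> \<star> tw w = (\<lambda>M. (-1) powi ((e \<beta> + 1) * word_deg e w) * (tw w \<star> \<delta>g \<beta>) M)"
      by (simp add: ce_mult_commute[OF has_parity_delta_gen]
          parity_twist_homogeneous[OF has_parity_theta_word] ce_mult_scale_left)
    moreover have "B (w @ [\<beta>]) = (-1) powi (e \<beta> * word_deg e w) * B (\<beta> # w)"
      using graded_symmetric_move[OF commutation_factor_theta Suc.prems, of "[]" w \<beta> "[]"]
      by (simp add: pass_factor_theta)
    moreover have "(-1) powi ((e \<beta> + 1) * word_deg e w)
        = (-1) powi (e \<beta> * word_deg e w) * ((-1) powi word_deg e w :: 'k)"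
      by (simp add: minus_one_powi_mult distrib_right)
    ultimately show ?thesis by (simp only: mult_ac)
  qed
  \<comment> \<open>A later letter is differentiated: the functions \<open>B (\<beta> # _)\<close> are graded symmetric as well.\<close>
  have IH: "(\<lambda>M. \<Sum>w\<in>words {1..n} i. B (\<beta> # w) * \<delta>w w M)
      = (\<lambda>M. \<Sum>w\<in>words {1..n} (i - 1). \<Sum>\<gamma>=1..n.
          of_nat i * (B (\<beta> # w @ [\<gamma>]) * (-1) powi word_deg e w) * (tw w \<star> \<delta>g \<gamma>) M)" for \<beta>
    using Suc.IH[OF graded_symmetric_Cons[OF Suc.prems]] by (simp add: sum_distrib_left mult.assoc)
  have "(\<Sum>w\<in>words {1..n} i. B (\<beta> # w) * (theta \<beta> \<star> \<delta>w w) M)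
      = (\<Sum>w\<in>words {1..n} (i - 1). \<Sum>\<gamma>=1..n.
          of_nat i * (B (\<beta> # w @ [\<gamma>]) * (-1) powi word_deg e w) * (theta \<beta> \<star> (tw w \<star> \<delta>g \<gamma>)) M)" for \<beta>
  proof -
    have "(\<Sum>w\<in>words {1..n} i. B (\<beta> # w) * (theta \<beta> \<star> \<delta>w w) M)
        = (theta \<beta> \<star> (\<lambda>M. \<Sum>w\<in>words {1..n} i. B (\<beta> # w) * \<delta>w w M)) M"
      by (rule filtered_linear_sum[OF filtered_linear_mult_left, symmetric])
    also have "\<dots> = (theta \<beta> \<star> (\<lambda>M. \<Sum>z\<in>words {1..n} (i - 1) \<times> {1..n}.
          (of_nat i * (B (\<beta> # fst z @ [snd z]) * (-1) powi word_deg e (fst z))) * (tw (fst z) \<star> \<delta>g (snd z)) M)) M"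
      unfolding IH by (simp add: sum.cartesian_product case_prod_beta)
    also have "\<dots> = (\<Sum>z\<in>words {1..n} (i - 1) \<times> {1..n}.
          (of_nat i * (B (\<beta> # fst z @ [snd z]) * (-1) powi word_deg e (fst z))) * (theta \<beta> \<star> (tw (fst z) \<star> \<delta>g (snd z))) M)"
      by (rule filtered_linear_sum[OF filtered_linear_mult_left])
    finally show ?thesis by (simp add: sum.cartesian_product case_prod_beta)
  qed
  note theta_sum = this
  have "(\<Sum>w\<in>words {1..n} i. B (\<beta> # w) * ((-1) powi e \<beta> * (theta \<beta> \<star> \<delta>w w) M))
      = (\<Sum>w\<in>words {1..n} (i - 1). \<Sum>\<gamma>=1..n.
          of_nat i * (B ((\<beta> # w) @ [\<gamma>]) * (-1) powi word_deg e (\<beta> # w) * (tw (\<beta> # w) \<star> \<delta>g \<gamma>) M))" for \<beta>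
  proof -
    have "(\<Sum>w\<in>words {1..n} i. B (\<beta> # w) * ((-1) powi e \<beta> * (theta \<beta> \<star> \<delta>w w) M))
        = (-1) powi e \<beta> * (\<Sum>w\<in>words {1..n} i. B (\<beta> # w) * (theta \<beta> \<star> \<delta>w w) M)"
      unfolding sum_distrib_left by (intro sum.cong refl) (simp only: mult_ac)
    also have "\<dots> = (\<Sum>w\<in>words {1..n} (i - 1). \<Sum>\<gamma>=1..n. (-1) powi e \<beta>
          * (of_nat i * (B (\<beta> # w @ [\<gamma>]) * (-1) powi word_deg e w) * (theta \<beta> \<star> (tw w \<star> \<delta>g \<gamma>)) M))"
      unfolding theta_sum sum_distrib_left ..
    also have "\<dots> = (\<Sum>w\<in>words {1..n} (i - 1). \<Sum>\<gamma>=1..n.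
          of_nat i * (B ((\<beta> # w) @ [\<gamma>]) * (-1) powi word_deg e (\<beta> # w) * (tw (\<beta> # w) \<star> \<delta>g \<gamma>) M))"
      by (intro sum.cong refl) (simp add: power_int_add ce_mult_assoc)
    finally show ?thesis .
  qed
  then have second: "(\<Sum>\<beta>=1..n. \<Sum>w\<in>words {1..n} i. B (\<beta> # w) * ((-1) powi e \<beta> * (theta \<beta> \<star> \<delta>w w) M))
      = (\<Sum>\<beta>=1..n. \<Sum>w\<in>words {1..n} (i - 1). \<Sum>\<gamma>=1..n.
          of_nat i * (B ((\<beta> # w) @ [\<gamma>]) * (-1) powi word_deg e (\<beta> # w) * (tw (\<beta> # w) \<star> \<delta>g \<gamma>) M))"
    by simp
  \<comment> \<open>For \<open>i = 0\<close> the truncated \<open>i - 1\<close> is harmless, because both sides carry the factor \<open>i\<close>.\<close>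
  have third: "\<dots> = of_nat i * (\<Sum>w\<in>words {1..n} i. \<Sum>\<gamma>=1..n.
          B (w @ [\<gamma>]) * (-1) powi word_deg e w * (tw w \<star> \<delta>g \<gamma>) M)"
  proof (cases i)
    case (Suc i')
    then show ?thesis by (simp only: diff_Suc_1 sum_words_Suc sum_distrib_left)
  qed simp
  have "(\<Sum>w\<in>words {1..n} (Suc i). B w * \<delta>w w M)
      = (\<Sum>\<beta>=1..n. \<Sum>w\<in>words {1..n} i. B (\<beta> # w) * (\<delta>g \<beta> \<star> tw w) M)
        + (\<Sum>\<beta>=1..n. \<Sum>w\<in>words {1..n} i. B (\<beta> # w) * ((-1) powi e \<beta> * (theta \<beta> \<star> \<delta>w w) M))"
    by (simp add: sum_words_Suc distrib_left sum.distrib)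
  also have "(\<Sum>\<beta>=1..n. \<Sum>w\<in>words {1..n} i. B (\<beta> # w) * (\<delta>g \<beta> \<star> tw w) M)
      = (\<Sum>w\<in>words {1..n} i. \<Sum>\<beta>=1..n. B (w @ [\<beta>]) * (-1) powi word_deg e w * (tw w \<star> \<delta>g \<beta>) M)"
    unfolding first by (rule sum.swap)
  finally show ?case unfolding second third by (simp add: distrib_right)
qed simp

text \<open>\<open>v\<close> is the argument of the inner bracket, and \<open>(-1)\<^bsup>|\<theta>\<^sup>u|\<^esup>\<close> stems from moving \<open>\<delta>\<close> past \<open>\<theta>\<^sup>u\<close>. There is
  no bracket without arguments, whence the value \<open>0\<close> for empty \<open>v\<close>.\<close>

definition composite :: "nat \<Rightarrow> nat list \<Rightarrow> nat list \<Rightarrow> 'k" where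
  "composite \<alpha> u v = (if v = [] then 0 else
     (\<Sum>\<beta>=1..n. sym_const \<alpha> (u @ [\<beta>]) * (-1) powi word_deg e u * sym_const \<beta> v))"

text \<open>Expanding both derivatives gives the sum of \<open>i / (i! j!) composite \<alpha> u v \<theta>\<^sup>u \<theta>\<^sup>v\<close> over words \<open>u\<close> of
  length \<open>i - 1\<close> and \<open>v\<close> of length \<open>j\<close>. At a monomial of weight \<open>k\<close> only \<open>(i - 1) + j = k\<close> contributes, and
  \<open>k! / ((i - 1)! j!)\<close> is the number of unshuffles that \<open>sum_words_unshuffle_sum\<close> accounts for.\<close>

lemma delta_square_generator:
  assumes k: "size M = k"
  shows "fact k * \<delta> (\<delta>g \<alpha>) M = (\<Sum>w\<in>words {1..n} k. tw w M * unshuffle_sum \<kappa> w (composite \<alpha>))"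
proof -
  let ?W = "words {1..n}"
  define E where "E p j = (\<Sum>u\<in>?W p. \<Sum>v\<in>?W j. composite \<alpha> u v * tw (u @ v) M)" for p j
  have inner: "(tw u \<star> \<delta>g \<beta>) M = (\<Sum>j=1..k. \<Sum>v\<in>?W j. 1 / fact j * sym_const \<beta> v * tw (u @ v) M)" for u \<beta>
    using filtered_linear_delta_gen[OF filtered_linear_mult_left, of M k n d "tw u" \<beta>] k
    by (simp add: theta_word_append)
  have E: "(\<Sum>u\<in>?W p. \<Sum>\<beta>=1..n. sym_const \<alpha> (u @ [\<beta>]) * (-1) powi word_deg e u * (tw u \<star> \<delta>g \<beta>) M)
      = (\<Sum>j=1..k. 1 / fact j * E p j)" for p
  proof -
    have "(\<Sum>\<beta>=1..n. sym_const \<alpha> (u @ [\<beta>]) * (-1) powi word_deg e u * (tw u \<star> \<delta>g \<beta>) M)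
      = (\<Sum>j=1..k. \<Sum>v\<in>?W j. 1 / fact j * (composite \<alpha> u v * tw (u @ v) M))" for u
    proof -
      have "(\<Sum>\<beta>=1..n. sym_const \<alpha> (u @ [\<beta>]) * (-1) powi word_deg e u * (tw u \<star> \<delta>g \<beta>) M)
        = (\<Sum>\<beta>=1..n. \<Sum>j=1..k. \<Sum>v\<in>?W j. 1 / fact j
            * ((sym_const \<alpha> (u @ [\<beta>]) * (-1) powi word_deg e u * sym_const \<beta> v) * tw (u @ v) M))"
        unfolding inner sum_distrib_left by (intro sum.cong refl) (simp add: mult_ac)
      also have "\<dots> = (\<Sum>j=1..k. \<Sum>v\<in>?W j. \<Sum>\<beta>=1..n. 1 / fact j
            * ((sym_const \<alpha> (u @ [\<beta>]) * (-1) powi word_deg e u * sym_const \<beta> v) * tw (u @ v) M))"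
        by (subst sum.swap) (intro sum.cong refl sum.swap)
      also have "\<dots> = (\<Sum>j=1..k. \<Sum>v\<in>?W j. 1 / fact j * (composite \<alpha> u v * tw (u @ v) M))"
      proof (intro sum.cong refl)
        fix j v assume "j \<in> {1..k}" "v \<in> ?W j"
        then have "v \<noteq> []" by (auto simp: words_def)
        then show "(\<Sum>\<beta>=1..n. 1 / fact j
            * ((sym_const \<alpha> (u @ [\<beta>]) * (-1) powi word_deg e u * sym_const \<beta> v) * tw (u @ v) M))
          = 1 / fact j * (composite \<alpha> u v * tw (u @ v) M)"
          by (simp add: composite_def sum_distrib_left sum_distrib_right)
      qed
      finally show ?thesis .
    qed
    then have "(\<Sum>u\<in>?W p. \<Sum>\<beta>=1..n. sym_const \<alpha> (u @ [\<beta>]) * (-1) powi word_deg e u * (tw u \<star> \<delta>g \<beta>) M)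
      = (\<Sum>u\<in>?W p. \<Sum>j=1..k. \<Sum>v\<in>?W j. 1 / fact j * (composite \<alpha> u v * tw (u @ v) M))"
      by simp
    also have "\<dots> = (\<Sum>j=1..k. 1 / fact j * E p j)"
      unfolding E_def sum_distrib_left by (rule sum.swap)
    finally show ?thesis .
  qed
  \<comment> \<open>Weights other than \<open>p + j\<close> do not occur in \<open>\<theta>\<^sup>u \<theta>\<^sup>v\<close>.\<close>
  have E0: "E p j = 0" if "p + j \<noteq> k" for p j
    unfolding E_def
  proof (intro sum.neutral ballI)
    fix u v assume "u \<in> ?W p" "v \<in> ?W j"
    then have "M \<noteq> mset (u @ v)" using that k by (auto simp: words_def)
    then show "composite \<alpha> u v * tw (u @ v) M = 0" using theta_word_support by fastforce
  qed
  have E1: "E p 0 = 0" for p by (simp add: E_def composite_def)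
  have "\<delta> (\<delta>g \<alpha>) M = (\<Sum>i=1..k. 1 / fact i * (\<Sum>w\<in>?W i. sym_const \<alpha> w * \<delta>w w M))"
    using filtered_linear_delta_gen[OF filtered_linear_delta, of M k \<alpha>] k
    by (simp add: delta_theta_word sum_distrib_left mult.assoc)
  also have "\<dots> = (\<Sum>i=1..k. 1 / fact i * (of_nat i * (\<Sum>j=1..k. 1 / fact j * E (i - 1) j)))"
    by (simp only: sum_symmetric_delta_word[OF graded_symmetric_sym_const] E)
  also have "\<dots> = (\<Sum>i=1..k. 1 / fact (i - 1) * (1 / fact (k - (i - 1)) * E (i - 1) (k - (i - 1))))"
  proof (intro sum.cong refl)
    fix i assume i: "i \<in> {1..k}"
    have "E (i - 1) j = 0" if "j \<noteq> k - (i - 1)" for j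
      by (rule E0) (use i that in auto)
    then have "(\<Sum>j=1..k. 1 / fact j * E (i - 1) j) = (\<Sum>j\<in>{k - (i - 1)}. 1 / fact j * E (i - 1) j)"
      by (intro sum.mono_neutral_right) (use i in auto)
    moreover have "1 / fact i * of_nat i = (1 / fact (i - 1) :: 'k)"
      using i fact_reduce[of i, where 'a = 'k] by auto
    ultimately show "1 / fact i * (of_nat i * (\<Sum>j=1..k. 1 / fact j * E (i - 1) j))
      = 1 / fact (i - 1) * (1 / fact (k - (i - 1)) * E (i - 1) (k - (i - 1)))"
      by (simp flip: mult.assoc)
  qed
  also have "\<dots> = (\<Sum>p<k. 1 / fact p * (1 / fact (k - p) * E p (k - p)))"
    by (rule sum.reindex_bij_witness[of _ "\<lambda>p. p + 1" "\<lambda>i. i - 1"]) auto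
  also have "\<dots> = (\<Sum>p\<le>k. 1 / fact p * (1 / fact (k - p) * E p (k - p)))"
    by (simp add: E1 flip: lessThan_Suc_atMost)
  finally have "fact k * \<delta> (\<delta>g \<alpha>) M = (\<Sum>p\<le>k. of_nat (k choose p) * E p (k - p))"
    by (simp add: sum_distrib_left binomial_fact mult.assoc)
  also have "\<dots> = (\<Sum>w\<in>?W k. tw w M * unshuffle_sum \<kappa> w (composite \<alpha>))"
    unfolding E_def
    by (rule sum_words_unshuffle_sum[symmetric, OF commutation_factor_theta _ graded_symmetric_theta_word]) simp
  finally show ?thesis .
qed

text \<open>The summand of the generalised Jacobi identity for the two blocks of an unshuffle, without \<open>\<epsilon>\<^sub>\<sigma>\<close>.\<close>

definition jacobi_term :: "nat \<Rightarrow> nat list \<Rightarrow> nat list \<Rightarrow> 'k" where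
  "jacobi_term \<alpha> u v = (if v = [] then 0 else
     (-1) powi (int (length v) * (int (length u) + word_deg d u)) * (\<Sum>\<beta>=1..n. c \<alpha> (u @ [\<beta>]) * c \<beta> v))"

text \<open>The two position signs of \<open>composite\<close> multiply to that of \<open>u @ v\<close> up to terms that involve the
  degree of the inserted index \<open>\<beta>\<close>, and \<open>d \<beta>\<close> is determined by \<open>v\<close> because the inner bracket is
  homogeneous of degree \<open>2 - length v\<close>. What remains besides the sign in \<open>jacobi_term\<close> is
  symmetric in \<open>u\<close> and \<open>v\<close>, hence invariant under unshuffling.\<close>

lemma composite_jacobi_term:
  "composite \<alpha> u v = (-1) powi (int (length u + length v) + word_deg d u + word_deg d v)
     * (position_sign d (u @ v) * jacobi_term \<alpha> u v)"
proof (cases "v = []")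
  case False
  have e: "word_deg e w = int (length w) - word_deg d w" for w
    by (induction w) (auto simp: theta_deg_def)
  have "sym_const \<alpha> (u @ [\<beta>]) * (-1) powi word_deg e u * sym_const \<beta> v
      = (-1) powi (int (length u + length v) + word_deg d u + word_deg d v) * position_sign d (u @ v)
        * (-1) powi (int (length v) * (int (length u) + word_deg d u)) * (c \<alpha> (u @ [\<beta>]) * c \<beta> v)" for \<beta>
  proof (cases "c \<beta> v = 0")
    case False
    then have \<beta>: "d \<beta> = word_deg d v + 2 - int (length v)" using c_degree \<open>v \<noteq> []\<close> by blast
    have "(-1) powi position_exponent d (u @ [\<beta>]) * (-1) powi word_deg e u * (-1) powi position_exponent d v
      = (-1) powi (int (length u + length v) + word_deg d u + word_deg d v)
        * (-1) powi position_exponent d (u @ v)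
        * ((-1) powi (int (length v) * (int (length u) + word_deg d u)) :: 'k)"
      unfolding minus_one_powi_mult
      by (rule minus_one_powi_cong) (simp add: position_exponent_append e \<beta> algebra_simps)
    then show ?thesis by (simp add: sym_const_def position_sign_def mult_ac)
  qed (simp add: sym_const_def)
  then show ?thesis using False by (simp add: composite_def jacobi_term_def sum_distrib_left mult.assoc)
qed (simp add: composite_def jacobi_term_def)

text \<open>The position sign transforms by the quotient of the Koszul sign of the generators and the sign in
  \<open>\<epsilon>\<^sub>\<sigma>\<close>, so \<open>unshuffle_sum_twist\<close> applies to it.\<close>

lemma unshuffle_sum_composite:
  "unshuffle_sum \<kappa> w (composite \<alpha>) = (-1) powi (int (length w) + word_deg d w) * position_sign d w
     * unshuffle_sum (skew_commutation d) w (jacobi_term \<alpha>)"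
proof -
  let ?s = "(-1) powi (int (length w) + word_deg d w) :: 'k"
  have "unshuffle_sum \<kappa> w (composite \<alpha>)
    = unshuffle_sum \<kappa> w (\<lambda>u v. ?s * (position_sign d (u @ v) * jacobi_term \<alpha> u v))"
  proof (rule unshuffle_sum_cong)
    fix u v assume uv: "mset u + mset v = mset w"
    have "length u + length v = length w" using arg_cong[OF uv, of size] by simp
    moreover have "word_deg d u + word_deg d v = word_deg d w"
      using arg_cong[OF uv, of "\<lambda>M. \<Sum>a\<in>#M. d a"] by (simp flip: mset_map add: sum_mset_sum_list)
    ultimately show "composite \<alpha> u v = ?s * (position_sign d (u @ v) * jacobi_term \<alpha> u v)"
      unfolding composite_jacobi_term by (simp add: add.assoc)
  qed
  also have "\<dots> = ?s * unshuffle_sum \<kappa> w (\<lambda>u v. position_sign d (u @ v) * jacobi_term \<alpha> u v)"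
    by (rule unshuffle_sum_scale)
  also have "graded_symmetric (\<lambda>a b. \<kappa> a b * skew_commutation d a b) (position_sign d :: _ \<Rightarrow> 'k)"
  proof -
    have "\<kappa> a b * skew_commutation d a b = ((-1) powi (d a + d b) :: 'k)" for a b
      by (simp add: theta_commutation_def skew_commutation_def theta_deg_def minus_one_powi)
    then show ?thesis unfolding graded_symmetric_def using position_sign_swap by metis
  qed
  note unshuffle_sum_twist[OF commutation_factor_theta commutation_factor_skew this, of w "[]", simplified]
  finally show ?thesis by (simp add: mult.assoc)
qed

lemma graded_symmetric_unshuffle_composite: "graded_symmetric \<kappa> (\<lambda>w. unshuffle_sum \<kappa> w (composite \<alpha>))"
proof (rule graded_symmetric_unshuffle_sum[OF commutation_factor_theta])
  have swap: "sym_const \<beta> (u @ a # b # v) = \<kappa> a b * sym_const \<beta> (u @ b # a # v)" for \<beta> u a b v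
    by (rule graded_symmetric_swap[OF graded_symmetric_sym_const])
  show "graded_symmetric \<kappa> (composite \<alpha> u)" for u
    unfolding graded_symmetric_def
  proof (intro allI)
    fix v a b v'
    show "composite \<alpha> u (v @ a # b # v') = \<kappa> a b * composite \<alpha> u (v @ b # a # v')"
      by (simp add: composite_def swap[of _ v a b v'] sum_distrib_left mult_ac)
  qed
  show "graded_symmetric \<kappa> (\<lambda>u. composite \<alpha> u v)" for v
    unfolding graded_symmetric_def
  proof (intro allI)
    fix u a b u'
    show "composite \<alpha> (u @ a # b # u') v = \<kappa> a b * composite \<alpha> (u @ b # a # u') v"
      using swap[of \<alpha> u a b "u' @ [_]"]
      by (simp add: composite_def sum_distrib_left mult_ac add_ac)
  qed
qed

text \<open>For the forward direction consider the coefficient of \<open>\<delta>\<^sup>2 \<theta>\<^sup>\<alpha>\<close> at the monomial with the letters of \<open>w\<close>.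
  The product of two functions that are graded symmetric for the same sign is invariant under
  rearrangement, so all words with these letters contribute the same amount, and their
  number is invertible in characteristic \<open>0\<close>.\<close>

lemma delta_square_generators_iff:
  "(\<forall>\<alpha>\<in>{1..n}. \<delta> (\<delta>g \<alpha>) = (\<lambda>M. 0))
    \<longleftrightarrow> (\<forall>\<alpha>\<in>{1..n}. \<forall>w. w \<noteq> [] \<longrightarrow> set w \<subseteq> {1..n} \<longrightarrow> unshuffle_sum \<kappa> w (composite \<alpha>) = 0)"
proof (intro iffI ballI allI impI)
  fix \<alpha> w
  assume D: "\<forall>\<alpha>\<in>{1..n}. \<delta> (\<delta>g \<alpha>) = (\<lambda>M. 0)" and \<alpha>: "\<alpha> \<in> {1..n}" and w: "set w \<subseteq> {1..n}"
  let ?\<Phi> = "\<lambda>w. unshuffle_sum \<kappa> w (composite \<alpha>)" and ?M = "mset w"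
  show "?\<Phi> w = 0"
  proof (cases "ce_monomial n d ?M")
    case False
    then show ?thesis
    proof (cases rule: not_ce_monomial_msetE)
      case (2 a)
      then show ?thesis using graded_symmetric_repeated[OF graded_symmetric_unshuffle_composite] by blast
    qed (use w in simp)
  next
    case True
    let ?S = "{w'. mset w' = ?M}"
    have S: "?S \<subseteq> words {1..n} (length w)"
    proof
      fix w' assume "w' \<in> ?S"
      then have "set w' = set w" "length w' = length w"
        using mset_eq_setD[of w' w] mset_eq_length[of w' w] by simp_all
      then show "w' \<in> words {1..n} (length w)" using w by (simp add: words_def)
    qed
    have const: "tw w' ?M * ?\<Phi> w' = tw w ?M * ?\<Phi> w" if "w' \<in> ?S" for w'
    proof -
      from that have "mset w' = mset w" by simp
      from graded_symmetric_same_letters[OF commutation_factor_theta[of d] this]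
      obtain s :: 'k where s: "s * s = 1" "\<And>F. graded_symmetric \<kappa> F \<Longrightarrow> F w' = s * F w" by metis
      have "tw w' ?M * ?\<Phi> w' = (s * s) * (tw w ?M * ?\<Phi> w)"
        unfolding s(2)[OF graded_symmetric_theta_word] s(2)[OF graded_symmetric_unshuffle_composite]
        by (simp only: mult_ac)
      then show ?thesis using s(1) by simp
    qed
    have "0 = (\<Sum>w'\<in>words {1..n} (length w). tw w' ?M * ?\<Phi> w')"
      using delta_square_generator[of ?M "length w" \<alpha>] D \<alpha> by simp
    also have "\<dots> = (\<Sum>w'\<in>?S. tw w' ?M * ?\<Phi> w')"
    proof (intro sum.mono_neutral_right S ballI)
      fix w' assume "w' \<in> words {1..n} (length w) - ?S"
      then have "tw w' ?M = 0" using theta_word_support[of n d w' ?M, where 'k = 'k] by fastforce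
      then show "tw w' ?M * ?\<Phi> w' = 0" by simp
    qed simp
    also have "\<dots> = (\<Sum>w'\<in>?S. tw w ?M * ?\<Phi> w)" by (rule sum.cong[OF refl const])
    also have "\<dots> = of_nat (card ?S) * (tw w ?M * ?\<Phi> w)" by simp
    finally have "of_nat (card ?S) * (tw w ?M * ?\<Phi> w) = 0" by simp
    moreover have "card ?S \<noteq> 0"
      using finite_subset[OF S] by (auto simp: card_eq_0_iff)
    moreover have "tw w ?M \<noteq> 0"
    proof -
      have "mset (sorted_list_of_multiset ?M) = mset w" by simp
      from graded_symmetric_same_letters[OF commutation_factor_theta[of d] this]
      obtain s :: 'k where "\<And>F. graded_symmetric \<kappa> F \<Longrightarrow> F (sorted_list_of_multiset ?M) = s * F w"
        by metis
      from this[OF graded_symmetric_theta_word, of n ?M] theta_word_sorted_list[OF True]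
      show ?thesis by (auto simp: monomial_def)
    qed
    ultimately show ?thesis by simp
  qed
next
  fix \<alpha>
  assume J: "\<forall>\<alpha>\<in>{1..n}. \<forall>w. w \<noteq> [] \<longrightarrow> set w \<subseteq> {1..n} \<longrightarrow> unshuffle_sum \<kappa> w (composite \<alpha>) = 0"
    and \<alpha>: "\<alpha> \<in> {1..n}"
  show "\<delta> (\<delta>g \<alpha>) = (\<lambda>M. 0)"
  proof
    fix M :: "nat multiset"
    have "unshuffle_sum \<kappa> w (composite \<alpha>) = 0" if "w \<in> words {1..n} (size M)" for w
    proof (cases "w = []")
      case True
      then show ?thesis by (simp add: composite_def)
    next
      case False
      then show ?thesis using J \<alpha> that by (simp add: words_def)
    qed
    then have "fact (size M) * \<delta> (\<delta>g \<alpha>) M = 0"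
      unfolding delta_square_generator[OF refl] by simp
    then show "\<delta> (\<delta>g \<alpha>) M = 0" by simp
  qed
qed

text \<open>The double sum over \<open>(i, j)\<close> and unshuffles runs over all proper subsets \<open>I\<close> of \<open>{1..k}\<close>, graded
  by cardinality. The full set may be added: its second block is empty, where \<open>jacobi_term\<close> is \<open>0\<close>.\<close>

lemma jacobi_sum:
  assumes "k \<ge> 1"
  shows "(\<Sum>(i, j) | 1 \<le> i \<and> 1 \<le> j \<and> (i - 1) + j = k. \<Sum>\<sigma>\<in>unshuffles (i - 1) j.
           perm_sign k (\<lambda>p. d (a p)) \<sigma>
           * (-1) powi (int j * (int (i - 1) + (\<Sum>p=1..i-1. d (a (\<sigma> p)))))
           * (\<Sum>\<beta>=1..n. c \<alpha> (map (\<lambda>p. a (\<sigma> p)) [1..<i] @ [\<beta>])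
                         * c \<beta> (map (\<lambda>p. a (\<sigma> p)) [i..<k+1])))
    = unshuffle_sum (skew_commutation d) (map a [1..<k+1]) (jacobi_term \<alpha>)" (is "?L = ?R")
proof -
  let ?s = "sorted_list_of_set :: nat set \<Rightarrow> nat list"
  let ?t = "\<lambda>I. crossing_factor (\<lambda>x y. - ((-1) powi (d (a x) * d (a y)))) I ({1..k} - I)
      * jacobi_term \<alpha> (map a (?s I)) (map a (?s ({1..k} - I)))"
  have "?L = (\<Sum>(i, j) | 1 \<le> i \<and> 1 \<le> j \<and> (i - 1) + j = k. \<Sum>I | I \<subseteq> {1..k} \<and> card I = i - 1. ?t I)"
  proof (rule sum.cong[OF refl], goal_cases)
    case (1 z)
    then obtain i j where z: "z = (i, j)" and ij: "1 \<le> i" "1 \<le> j" "i - 1 + j = k" by auto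
    define p where "p = i - 1"
    have i: "i = p + 1" and k: "k = p + j" using ij by (simp_all add: p_def)
    have "(\<Sum>q=1..p. d (a (\<sigma> q))) = word_deg d (map (\<lambda>q. a (\<sigma> q)) [1..<p+1])" for \<sigma>
      by (simp add: comp_def interv_sum_list_conv_sum_set_nat atLeastLessThanSuc_atLeastAtMost del: upt_Suc)
    then have "(\<Sum>\<sigma>\<in>unshuffles p j. perm_sign (p + j) (\<lambda>q. d (a q)) \<sigma>
           * (-1) powi (int j * (int p + (\<Sum>q=1..p. d (a (\<sigma> q)))))
           * (\<Sum>\<beta>=1..n. c \<alpha> (map (\<lambda>q. a (\<sigma> q)) [1..<p+1] @ [\<beta>])
                         * c \<beta> (map (\<lambda>q. a (\<sigma> q)) [p+1..<p+j+1])))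
      = (\<Sum>\<sigma>\<in>unshuffles p j. perm_sign (p + j) (\<lambda>q. d (a q)) \<sigma>
           * jacobi_term \<alpha> (map (\<lambda>q. a (\<sigma> q)) [1..<p+1]) (map (\<lambda>q. a (\<sigma> q)) [p+1..<p+j+1]))"
      using ij(2) by (simp add: jacobi_term_def mult.assoc del: upt_Suc)
    note trans[OF this sum_unshuffles]
    then show ?case unfolding z prod.case i diff_add_inverse2 k .
  qed
  also have "\<dots> = (\<Sum>p<k. \<Sum>I | I \<subseteq> {1..k} \<and> card I = p. ?t I)"
    by (rule sum.reindex_bij_witness[of _ "\<lambda>p. (p + 1, k - p)" "\<lambda>(i, j). i - 1"]) auto
  also have "\<dots> = (\<Sum>p\<le>k. \<Sum>I | I \<subseteq> {1..k} \<and> card I = p. ?t I)"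
  proof -
    have "I = {1..k}" if "I \<subseteq> {1..k}" "card I = k" for I
      using card_subset_eq[of "{1..k}" I] that by simp
    then have "(\<Sum>I | I \<subseteq> {1..k} \<and> card I = k. ?t I) = 0"
      by (intro sum.neutral) (auto simp: jacobi_term_def)
    then show ?thesis by (simp flip: lessThan_Suc_atMost)
  qed
  also have "\<dots> = (\<Sum>I\<in>Pow {1..k}. ?t I)"
  proof -
    have "card I \<le> k" if "I \<subseteq> {1..k}" for I
      using card_mono[of "{1..k}" I] that by simp
    then have "(\<Sum>p\<in>{..k}. sum ?t {I \<in> Pow {1..k}. card I = p}) = sum ?t (Pow {1..k})"
      by (intro sum.group) auto
    then show ?thesis by (simp add: Pow_def)
  qed
  also have "\<dots> = unshuffle_sum (skew_commutation d) (map a (?s {1..k})) (jacobi_term \<alpha>)"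
    by (subst unshuffle_sum_subsets) (simp_all add: skew_commutation_def)
  also have "?s {1..k} = [1..<k+1]"
    using sorted_list_of_set_range[of 1 "k+1"] by (simp add: atLeastLessThanSuc_atLeastAtMost del: upt_Suc)
  finally show ?thesis .
qed

theorem delta_square_zero_iff_jacobi:
  "(\<forall>f\<in>CE n d. \<delta> (\<delta> f) = (\<lambda>M. 0)) \<longleftrightarrow> generalised_jacobi n d c"
proof -
  have theta_CE: "theta \<alpha> \<in> (CE n d :: (nat multiset \<Rightarrow> 'k) set)" if "\<alpha> \<in> {1..n}" for \<alpha>
    using delta_theta(2)[OF that] by (auto simp: CE_def formal_series_def theta_def)
  have CE_series: "CE n d \<subseteq> (formal_series n d :: (nat multiset \<Rightarrow> 'k) set)"
    by (auto simp: CE_def formal_series_def)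
  have "(\<forall>f\<in>CE n d. \<delta> (\<delta> f) = (\<lambda>M. 0)) \<longleftrightarrow> (\<forall>\<alpha>\<in>{1..n}. \<delta> (\<delta>g \<alpha>) = (\<lambda>M. 0))"
    using theta_CE delta_theta(1) CE_series delta_square_zero_iff_generators by (metis subsetD)
  also have "\<dots> \<longleftrightarrow> (\<forall>\<alpha>\<in>{1..n}. \<forall>w. w \<noteq> [] \<longrightarrow> set w \<subseteq> {1..n} \<longrightarrow>
      unshuffle_sum (skew_commutation d) w (jacobi_term \<alpha>) = 0)"
    unfolding delta_square_generators_iff unshuffle_sum_composite position_sign_def by simp
  also have "\<dots> \<longleftrightarrow> (\<forall>k\<ge>1. \<forall>\<alpha>\<in>{1..n}. \<forall>a. (\<forall>p\<in>{1..k}. a p \<in> {1..n}) \<longrightarrow>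
      unshuffle_sum (skew_commutation d) (map a [1..<k+1]) (jacobi_term \<alpha>) = 0)" (is "?A \<longleftrightarrow> ?B")
  proof
    assume ?A
    show ?B
    proof (intro allI ballI impI)
      fix k \<alpha> and a :: "nat \<Rightarrow> nat"
      assume "k \<ge> 1" "\<alpha> \<in> {1..n}" "\<forall>p\<in>{1..k}. a p \<in> {1..n}"
      moreover from this have "map a [1..<k+1] \<noteq> []" "set (map a [1..<k+1]) \<subseteq> {1..n}" by auto
      ultimately show "unshuffle_sum (skew_commutation d) (map a [1..<k+1]) (jacobi_term \<alpha>) = 0"
        using \<open>?A\<close> by blast
    qed
  next
    assume B: ?B
    show ?A
    proof (intro ballI allI impI)
      fix \<alpha> and w :: "nat list"
      assume "\<alpha> \<in> {1..n}" "w \<noteq> []" and w: "set w \<subseteq> {1..n}"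
      have "map (\<lambda>p. w ! (p - 1)) [1..<length w + 1] = w"
        by (rule nth_equalityI) (simp_all del: upt_Suc)
      moreover have "\<forall>p\<in>{1..length w}. w ! (p - 1) \<in> {1..n}"
      proof
        fix p assume "p \<in> {1..length w}"
        then have "w ! (p - 1) \<in> set w" by (intro nth_mem) auto
        with w show "w ! (p - 1) \<in> {1..n}" by blast
      qed
      moreover have "length w \<ge> 1" using \<open>w \<noteq> []\<close> by (cases w) auto
      ultimately show "unshuffle_sum (skew_commutation d) w (jacobi_term \<alpha>) = 0"
        using B \<open>\<alpha> \<in> {1..n}\<close> by metis
    qed
  qed
  also have "\<dots> \<longleftrightarrow> generalised_jacobi n d c"
    unfolding generalised_jacobi_def using jacobi_sum by simp
  finally show ?thesis .
qed

end

section \<open>Structure constants of a graded skew family\<close>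

text \<open>Neither \<open>\<delta>\<close> nor the Jacobi identity involves indices outside \<open>{1..n}\<close>, and the vectors assigned to such
  indices are arbitrary; setting the constants to \<open>0\<close> there yields an instance of \<open>ce_derivation\<close>.\<close>

definition restrict_const :: "nat \<Rightarrow> (nat \<Rightarrow> nat list \<Rightarrow> 'k::zero) \<Rightarrow> nat \<Rightarrow> nat list \<Rightarrow> 'k" where
  "restrict_const n c \<alpha> w = (if \<alpha> \<in> {1..n} \<and> set w \<subseteq> {1..n} then c \<alpha> w else 0)"

context
  fixes scale :: "'k::field_char_0 \<Rightarrow> 'v::ab_group_add \<Rightarrow> 'v"
    and G :: "int \<Rightarrow> 'v set" and n :: nat and x :: "nat \<Rightarrow> 'v" and d :: "nat \<Rightarrow> int"
  assumes vs: "vector_space scale" and grading: "is_grading scale G"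
    and basis: "homogeneous_basis scale G n x d"
begin

interpretation vector_space scale by (rule vs)

lemma basis_facts:
  "inj_on x {1..n}" "independent (x ` {1..n})" "span (x ` {1..n}) = UNIV"
  "\<alpha> \<in> {1..n} \<Longrightarrow> x \<alpha> \<in> G (d \<alpha>)"
  using basis by (auto simp: homogeneous_basis_def)

text \<open>Collecting the basis expansion of \<open>v\<close> by degree gives a decomposition into homogeneous
  components, as does \<open>v\<close> itself; by uniqueness the component of each degree other than \<open>m\<close> is zero, and
  so are its coefficients.\<close>

lemma coefficient_homogeneous:
  assumes v: "v \<in> G m" and \<alpha>: "\<alpha> \<in> {1..n}" and nz: "representation (x ` {1..n}) v (x \<alpha>) \<noteq> 0"
  shows "d \<alpha> = m"
proof -
  let ?r = "representation (x ` {1..n}) v"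
  have sub: "subspace (G j)" for j using grading by (simp add: is_grading_def)
  define comp where "comp j = (\<Sum>\<beta> | \<beta> \<in> {1..n} \<and> d \<beta> = j. scale (?r (x \<beta>)) (x \<beta>))" for j
  have comp_G: "comp j \<in> G j" for j
    unfolding comp_def using basis_facts(4) by (intro subspace_sum sub subspace_scale) auto
  have supp: "{j. comp j \<noteq> 0} \<subseteq> d ` {1..n}"
  proof
    fix j assume "j \<in> {j. comp j \<noteq> 0}"
    then obtain \<beta> where "\<beta> \<in> {1..n}" "d \<beta> = j"
      unfolding comp_def by (auto elim!: sum.not_neutral_contains_not_neutral)
    then show "j \<in> d ` {1..n}" by auto
  qed
  have "v = (\<Sum>b\<in>x ` {1..n}. scale (?r b) b)"
    using sum_representation_eq[OF basis_facts(2), of v "x ` {1..n}"] basis_facts(3) by simp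
  also have "\<dots> = (\<Sum>\<beta>=1..n. scale (?r (x \<beta>)) (x \<beta>))"
    by (rule sum.reindex_cong[OF basis_facts(1)]) auto
  also have "\<dots> = (\<Sum>j\<in>d ` {1..n}. comp j)"
    unfolding comp_def
    using sum.group[of "{1..n}" "d ` {1..n}" d "\<lambda>\<beta>. scale (?r (x \<beta>)) (x \<beta>)"] by simp
  also have "\<dots> = (\<Sum>j | comp j \<noteq> 0. comp j)"
    by (rule sum.mono_neutral_right) (use supp in auto)
  finally have "v = (\<Sum>j | comp j \<noteq> 0. comp j)" .
  moreover have "finite {j. comp j \<noteq> 0}" using finite_subset[OF supp] by simp
  moreover define single where "single j = (if j = m then v else 0)" for j
  have "single j \<in> G j" for j using v subspace_0[OF sub] by (simp add: single_def)
  moreover have "{j. single j \<noteq> 0} = (if v = 0 then {} else {m})" by (auto simp: single_def)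
  then have "finite {j. single j \<noteq> 0}" "v = (\<Sum>j | single j \<noteq> 0. single j)"
    by (auto simp: single_def)
  moreover have "\<exists>!c. (\<forall>m. c m \<in> G m) \<and> finite {m. c m \<noteq> 0} \<and> v = (\<Sum>m | c m \<noteq> 0. c m)"
    using grading by (simp add: is_grading_def)
  ultimately have eq: "comp = single" using comp_G by blast
  show ?thesis
  proof (rule ccontr)
    assume "d \<alpha> \<noteq> m"
    then have "comp (d \<alpha>) = 0" by (simp add: eq single_def)
    moreover have "representation (x ` {1..n}) (comp (d \<alpha>)) (x \<alpha>)
        = (\<Sum>\<beta> | \<beta> \<in> {1..n} \<and> d \<beta> = d \<alpha>. if \<beta> = \<alpha> then ?r (x \<alpha>) else 0)"
    proof -
      have "representation (x ` {1..n}) (comp (d \<alpha>)) (x \<alpha>)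
          = (\<Sum>\<beta> | \<beta> \<in> {1..n} \<and> d \<beta> = d \<alpha>. representation (x ` {1..n}) (scale (?r (x \<beta>)) (x \<beta>)) (x \<alpha>))"
        unfolding comp_def using basis_facts(2,3) by (subst representation_sum) auto
      also have "\<dots> = (\<Sum>\<beta> | \<beta> \<in> {1..n} \<and> d \<beta> = d \<alpha>. if \<beta> = \<alpha> then ?r (x \<alpha>) else 0)"
      proof (intro sum.cong refl)
        fix \<beta> assume "\<beta> \<in> {\<beta>. \<beta> \<in> {1..n} \<and> d \<beta> = d \<alpha>}"
        then have "\<beta> \<in> {1..n}" by simp
        then have "x \<alpha> = x \<beta> \<longleftrightarrow> \<beta> = \<alpha>" "x \<beta> \<in> x ` {1..n}"
          using inj_onD[OF basis_facts(1), of \<alpha> \<beta>] \<alpha> by auto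
        then show "representation (x ` {1..n}) (scale (?r (x \<beta>)) (x \<beta>)) (x \<alpha>) = (if \<beta> = \<alpha> then ?r (x \<alpha>) else 0)"
          using basis_facts(2,3) by (simp add: representation_scale representation_basis)
      qed
      finally show ?thesis .
    qed
    ultimately show False using nz \<alpha> by (simp add: representation_zero)
  qed
qed

context
  fixes L :: "nat \<Rightarrow> 'v list \<Rightarrow> 'v"
  assumes L: "graded_skew_family scale G L"
begin

lemma struct_const_degree:
  assumes "w \<noteq> []" "set w \<subseteq> {1..n}" "\<alpha> \<in> {1..n}" "struct_const scale n x L \<alpha> w \<noteq> 0"
  shows "d \<alpha> = word_deg d w + 2 - int (length w)"
proof -
  have "\<forall>p<length w. map x w ! p \<in> G (map d w ! p)"
    using assms(2) basis_facts(4) by (auto simp: subset_iff)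
  moreover have "length w \<ge> 1" using assms(1) by (cases w) auto
  ultimately have "L (length w) (map x w) \<in> G (sum_list (map d w) + (2 - int (length w)))"
    using L[unfolded graded_skew_family_def, rule_format, of "length w" "map x w"] by simp
  from coefficient_homogeneous[OF this assms(3)] assms(4) show ?thesis
    by (simp add: struct_const_def)
qed

lemma struct_const_skew:
  assumes "set (u @ a # b # v) \<subseteq> {1..n}"
  shows "struct_const scale n x L \<alpha> (u @ a # b # v)
    = skew_commutation d a b * struct_const scale n x L \<alpha> (u @ b # a # v)"
proof -
  let ?w = "u @ b # a # v"
  let ?vs = "map x ?w" and ?p = "length u"
  have "x b \<in> G (d b)" "x a \<in> G (d a)" using assms basis_facts(4) by auto
  then have "Suc ?p < length ?w \<and> ?vs ! ?p \<in> G (d b) \<and> ?vs ! Suc ?p \<in> G (d a)"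
    by (simp add: nth_append)
  then have "L (length ?w) (?vs[?p := ?vs ! Suc ?p, Suc ?p := ?vs ! ?p])
      = scale (- ((-1) powi (d b * d a))) (L (length ?w) ?vs)"
    using L[unfolded graded_skew_family_def, rule_format, of "length ?w" ?vs] by simp
  moreover have "?vs[?p := ?vs ! Suc ?p, Suc ?p := ?vs ! ?p] = map x (u @ a # b # v)"
    by (simp add: nth_append list_update_append)
  ultimately have "L (length (u @ a # b # v)) (map x (u @ a # b # v))
      = scale (skew_commutation d a b) (L (length ?w) ?vs)"
    by (simp add: skew_commutation_def mult.commute)
  then show ?thesis
    unfolding struct_const_def
    using representation_scale[OF basis_facts(2), of "L (length ?w) ?vs"] basis_facts(3) by simp
qed

lemma ce_derivation_struct_const:
  "ce_derivation n d (restrict_const n (struct_const scale n x L))"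
proof
  let ?c = "restrict_const n (struct_const scale n x L)"
  show "?c \<alpha> w \<noteq> 0 \<Longrightarrow> \<alpha> \<in> {1..n} \<and> set w \<subseteq> {1..n}" for \<alpha> w
    by (auto simp: restrict_const_def split: if_splits)
  show "d \<alpha> = word_deg d w + 2 - int (length w)" if "w \<noteq> []" "?c \<alpha> w \<noteq> 0" for \<alpha> w
    using that struct_const_degree[of w \<alpha>] by (simp add: restrict_const_def split: if_splits)
  show "graded_symmetric (skew_commutation d) (?c \<alpha>)" for \<alpha>
    unfolding graded_symmetric_def
  proof (intro allI)
    fix u a b v
    show "?c \<alpha> (u @ a # b # v) = skew_commutation d a b * ?c \<alpha> (u @ b # a # v)"
    proof (cases "\<alpha> \<in> {1..n} \<and> set (u @ a # b # v) \<subseteq> {1..n}")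
      case True
      moreover from True have "\<alpha> \<in> {1..n} \<and> set (u @ b # a # v) \<subseteq> {1..n}" by auto
      ultimately show ?thesis
        using struct_const_skew[of u a b v \<alpha>] unfolding restrict_const_def by (simp only: if_True simp_thms)
    next
      case False
      then have "\<not> (\<alpha> \<in> {1..n} \<and> set (u @ b # a # v) \<subseteq> {1..n})" by auto
      with False show ?thesis unfolding restrict_const_def by (simp only: if_False mult_zero_right)
    qed
  qed
qed

end

end

lemma delta_word_cong:
  assumes "\<And>\<alpha> w. \<alpha> \<in> {1..n} \<Longrightarrow> set w \<subseteq> {1..n} \<Longrightarrow> c \<alpha> w = c' \<alpha> w" "set w \<subseteq> {1..n}"
  shows "delta_word n d c w = delta_word n d c' w"
proof -
  have "delta_gen n d c \<alpha> = delta_gen n d c' \<alpha>" if "\<alpha> \<in> {1..n}" for \<alpha>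
    unfolding delta_gen_def using assms(1)[OF that] by (intro ext sum.cong refl) auto
  then show ?thesis using assms(2) by (induction w) auto
qed

lemma delta_cong:
  assumes "\<And>\<alpha> w. \<alpha> \<in> {1..n} \<Longrightarrow> set w \<subseteq> {1..n} \<Longrightarrow> c \<alpha> w = c' \<alpha> w"
  shows "delta n d c = delta n d c'"
  unfolding delta_def
proof (intro ext sum.cong refl)
  fix f :: "nat multiset \<Rightarrow> 'a" and M N :: "nat multiset"
  assume "N \<in> {N. ce_monomial n d N \<and> size N \<le> size M}"
  then have "delta_word n d c (sorted_list_of_multiset N) = delta_word n d c' (sorted_list_of_multiset N)"
    by (intro delta_word_cong assms) (simp_all add: ce_monomial_def)
  then show "f N * delta_word n d c (sorted_list_of_multiset N) M
      = f N * delta_word n d c' (sorted_list_of_multiset N) M" by simp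
qed

lemma generalised_jacobi_cong:
  assumes "\<And>\<alpha> w. \<alpha> \<in> {1..n} \<Longrightarrow> set w \<subseteq> {1..n} \<Longrightarrow> c \<alpha> w = c' \<alpha> w"
  shows "generalised_jacobi n d c \<longleftrightarrow> generalised_jacobi n d c'"
proof -
  have products: "c \<alpha> (map (\<lambda>p. a (\<sigma> p)) [1..<i] @ [\<beta>]) * c \<beta> (map (\<lambda>p. a (\<sigma> p)) [i..<k+1])
      = c' \<alpha> (map (\<lambda>p. a (\<sigma> p)) [1..<i] @ [\<beta>]) * c' \<beta> (map (\<lambda>p. a (\<sigma> p)) [i..<k+1])"
    if "\<sigma> \<in> unshuffles (i - 1) j" "1 \<le> i" "1 \<le> j" "i - 1 + j = k" "\<forall>p\<in>{1..k}. a p \<in> {1..n}"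
      "\<alpha> \<in> {1..n}" "\<beta> \<in> {1..n}" for i j k a \<alpha> \<beta> \<sigma>
  proof -
    have "\<sigma> permutes {1..k}" using that by (simp add: unshuffles_def)
    then have "a (\<sigma> p) \<in> {1..n}" if "p \<in> {1..k}" for p
      using \<open>\<forall>p\<in>{1..k}. a p \<in> {1..n}\<close> that permutes_in_image[of \<sigma> "{1..k}" p] by blast
    moreover have "set [1..<i] \<subseteq> {1..k}" "set [i..<k+1] \<subseteq> {1..k}" using that(2-4) by auto
    ultimately have "set (map (\<lambda>p. a (\<sigma> p)) [1..<i] @ [\<beta>]) \<subseteq> {1..n}" "set (map (\<lambda>p. a (\<sigma> p)) [i..<k+1]) \<subseteq> {1..n}"
      unfolding set_append set_map list.set using that(7) by blast+
    with assms that(6,7) show ?thesis by simp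
  qed
  define S where "S c k \<alpha> a = (\<Sum>(i, j) | 1 \<le> i \<and> 1 \<le> j \<and> (i - 1) + j = k. \<Sum>\<sigma>\<in>unshuffles (i - 1) j.
           perm_sign k (\<lambda>p. d (a p)) \<sigma>
           * (-1) powi (int j * (int (i - 1) + (\<Sum>p=1..i-1. d (a (\<sigma> p)))))
           * (\<Sum>\<beta>=1..n. c \<alpha> (map (\<lambda>p. a (\<sigma> p)) [1..<i] @ [\<beta>])
                         * c \<beta> (map (\<lambda>p. a (\<sigma> p)) [i..<k+1])))"
    for c :: "nat \<Rightarrow> nat list \<Rightarrow> 'a" and k \<alpha> and a :: "nat \<Rightarrow> nat"
  have "S c k \<alpha> a = S c' k \<alpha> a" if "\<alpha> \<in> {1..n}" "\<forall>p\<in>{1..k}. a p \<in> {1..n}" for k \<alpha> a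
    unfolding S_def
  proof (rule sum.cong[OF refl], goal_cases)
    case (1 z)
    then obtain i j where z: "z = (i, j)" and "1 \<le> i" "1 \<le> j" "i - 1 + j = k" by auto
    with that show ?case
      unfolding z prod.case by (intro sum.cong refl arg_cong2[of _ _ _ _ "(*)"] products)
  qed
  then show ?thesis
    unfolding generalised_jacobi_def S_def[symmetric] by metis
qed

theorem proposition4p6:
  fixes scale :: "'k::field_char_0 \<Rightarrow> 'v::ab_group_add \<Rightarrow> 'v"
    and G :: "int \<Rightarrow> 'v set"
    and n :: nat
    and x :: "nat \<Rightarrow> 'v"
    and d :: "nat \<Rightarrow> int"
    and L :: "nat \<Rightarrow> 'v list \<Rightarrow> 'v"
  assumes "vector_space scale"
    and "is_grading scale G"
    and "homogeneous_basis scale G n x d"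
    and "graded_skew_family scale G L"
  shows "(\<forall>f\<in>CE n d. delta n d (struct_const scale n x L)
                        (delta n d (struct_const scale n x L) f) = (\<lambda>M. 0))
         \<longleftrightarrow> generalised_jacobi n d (struct_const scale n x L)"
proof -
  let ?c = "struct_const scale n x L" and ?c' = "restrict_const n (struct_const scale n x L)"
  have eq: "?c \<alpha> w = ?c' \<alpha> w" if "\<alpha> \<in> {1..n}" "set w \<subseteq> {1..n}" for \<alpha> w
    using that by (simp add: restrict_const_def)
  interpret ce_derivation n d ?c' by (rule ce_derivation_struct_const[OF assms])
  have "delta n d ?c = delta n d ?c'" by (rule delta_cong[OF eq])
  moreover have "generalised_jacobi n d ?c \<longleftrightarrow> generalised_jacobi n d ?c'"
    by (rule generalised_jacobi_cong[OF eq])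
  ultimately show ?thesis using delta_square_zero_iff_jacobi by simp
qed

end
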